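(* Let $h\in C_0^\infty(\mathbb{R}_+)'$ be an arbitrary distribution on $\mathbb{R}_+$, and let $\sigma=(\mathsf{L}^* )^{-1}h\in\mathcal{Y}'$ be its sigma-function. Then $$\langle h,\ \bar f_1\star f_2\rangle=\langle \sigma,\ (\mathsf{L}f_1)^*\,\mathsf{L}f_2\rangle$$ for all $f_1,f_2\in C_0^\infty(\mathbb{R}_+)$.
   Context: $\mathbb{R}_+=(0,\infty)$, and $C_0^\infty(\mathbb{R}_+)$ is the space of complex-valued smooth functions with compact support in $(0,\infty)$, with its usual topology. The prime denotes the dual space. The duality symbols $\langle\cdot,\cdot\rangle$ are linear in the first argument and antilinear in the second; for a locally integrable function $h$, $\langle h,f\rangle=\int_0^\infty h(t)\overline{f(t)}\,dt$. The Laplace transform is $(\mathsf{L}f)(\lambda)=\int_0^\infty e^{-t\lambda}f(t)\,dt$, $\lambda\in\mathbb{C}$. The space $\mathcal{Y}$ consists of the entire functions $g(\lambda)$, $\lambda\in\mathbb{C}$, that decay exponentially as $\operatorname{Re}\lambda\to+\infty$, are exponentially bounded as $\operatorname{Re}\lambda\to-\infty$, and decay faster than any power of $|\lambda|^{-1}$ as $|\operatorname{Im}\lambda|\to\infty$. More precisely, there are $r_+=r_+(g)<0$ and $r_-=r_-(g)\in\mathbb{R}$ such that for every $n$ one has $|g(\lambda)|\le C_n(1+|\lambda|)^{-n}e^{r_\pm|\operatorname{Re}\lambda|}$ for $\pm\operatorname{Re}\lambda\ge0$. By the Paley–Wiener theorem, $\mathsf{L}$ is a bijection of $C_0^\infty(\mathbb{R}_+)$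 onto $\mathcal{Y}$, and $\mathcal{Y}$ carries the topology making $\mathsf{L}$ an isomorphism. By duality, $\mathsf{L}^*:\mathcal{Y}'\to C_0^\infty(\mathbb{R}_+)'$, defined by $\langle\mathsf{L}^*\sigma,f\rangle=\langle\sigma,\mathsf{L}f\rangle$, is also an isomorphism, so $\sigma=(\mathsf{L}^* )^{-1}h$ is well defined; formally $h(t)=\int_0^\infty e^{-t\lambda}\sigma(\lambda)\,d\lambda$. For $g\in\mathcal{Y}$, $g^*(\lambda)=\overline{g(\bar\lambda)}$. The Laplace convolution is $(\bar f_1\star f_2)(t)=\int_0^\infty\overline{f_1(s)}\,f_2(t-s)\,ds$, where $f_2$ is extended by zero to $(-\infty,0]$. (Formally, $\langle h,\bar f_1\star f_2\rangle=(Hf_1,f_2)$ for the Hankel operator $(Hu)(t)=\int_0^\infty h(t+s)u(s)\,ds$.) *)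

theory Defs
  imports "HOL-Complex_Analysis.Complex_Analysis"
begin

subsection \<open>Test functions on the positive half-line\<close>

text \<open>
  A function on \<open>(0,\<infinity>)\<close> with compact support there is represented by its extension by zero
  to \<open>\<real>\<close>.
\<close>

definition nth_deriv :: "nat \<Rightarrow> (real \<Rightarrow> complex) \<Rightarrow> real \<Rightarrow> complex" where
  "nth_deriv n f = ((\<lambda>u t. vector_derivative u (at t)) ^^ n) f"

definition smooth :: "(real \<Rightarrow> complex) \<Rightarrow> bool" where
  "smooth f \<longleftrightarrow> (\<forall>n t. nth_deriv n f differentiable (at t))"

definition test_functions_on :: "real set \<Rightarrow> (real \<Rightarrow> complex) set" where
  "test_functions_on K = {f. smooth f \<and> (\<forall>t. t \<notin> K \<longrightarrow> f t = 0)}"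

definition test_functions :: "(real \<Rightarrow> complex) set" where
  "test_functions = (\<Union>K \<in> {K. compact K \<and> K \<subseteq> {0<..}}. test_functions_on K)"

text \<open>
  The usual topology of \<open>C\<^sub>0\<^sup>\<infinity>(\<real>\<^sub>+)\<close> is the locally convex inductive limit of the Frechet spaces
  of smooth functions supported in a fixed compact \<open>K\<close>, the latter with the topology of uniform
  convergence of all derivatives. Its basic neighbourhoods of zero are the absolutely convex
  sets whose trace on each of these Frechet spaces is a neighbourhood of zero there.
\<close>

definition absolutely_convex :: "(real \<Rightarrow> complex) set \<Rightarrow> bool" where
  "absolutely_convex W \<longleftrightarrow>
     (\<forall>u\<in>W. \<forall>v\<in>W. \<forall>a b :: complex. norm a + norm b \<le> 1 \<longrightarrow> (\<lambda>t. a * u t + b * v t) \<in> W)"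

definition basic_zero_nhd :: "(real \<Rightarrow> complex) set \<Rightarrow> bool" where
  "basic_zero_nhd W \<longleftrightarrow> W \<subseteq> test_functions \<and> absolutely_convex W \<and>
     (\<forall>K. compact K \<and> K \<subseteq> {0<..} \<longrightarrow>
        (\<exists>n. \<exists>\<epsilon>>0. \<forall>u\<in>test_functions_on K.
           (\<forall>k\<le>n. \<forall>t. norm (nth_deriv k u t) < \<epsilon>) \<longrightarrow> u \<in> W))"

definition test_open :: "(real \<Rightarrow> complex) set \<Rightarrow> bool" where
  "test_open U \<longleftrightarrow> U \<subseteq> test_functions \<and>
     (\<forall>f\<in>U. \<exists>W. basic_zero_nhd W \<and> (\<forall>w\<in>W. (\<lambda>t. f t + w t) \<in> U))"

definition test_topology :: "(real \<Rightarrow> complex) topology" where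
  "test_topology = topology test_open"

lemma basic_zero_nhd_Int:
  assumes "basic_zero_nhd V" "basic_zero_nhd W"
  shows "basic_zero_nhd (V \<inter> W)"
  unfolding basic_zero_nhd_def
proof (intro conjI allI impI)
  show "V \<inter> W \<subseteq> test_functions" "absolutely_convex (V \<inter> W)"
    using assms by (auto simp: basic_zero_nhd_def absolutely_convex_def)
  fix K :: "real set" assume K: "compact K \<and> K \<subseteq> {0<..}"
  obtain m \<delta> where 1: "\<delta> > 0" "\<And>u. u \<in> test_functions_on K \<Longrightarrow>
      (\<forall>k\<le>m. \<forall>t. norm (nth_deriv k u t) < \<delta>) \<Longrightarrow> u \<in> V"
    using assms(1) K unfolding basic_zero_nhd_def by metis
  obtain n \<epsilon> where 2: "\<epsilon> > 0" "\<And>u. u \<in> test_functions_on K \<Longrightarrow>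
      (\<forall>k\<le>n. \<forall>t. norm (nth_deriv k u t) < \<epsilon>) \<Longrightarrow> u \<in> W"
    using assms(2) K unfolding basic_zero_nhd_def by metis
  show "\<exists>n. \<exists>\<epsilon>>0. \<forall>u\<in>test_functions_on K.
           (\<forall>k\<le>n. \<forall>t. norm (nth_deriv k u t) < \<epsilon>) \<longrightarrow> u \<in> V \<inter> W"
    by (rule exI[of _ "max m n"], rule exI[of _ "min \<delta> \<epsilon>"]) (use 1 2 in auto)
qed

lemma istopology_test_open: "istopology test_open"
  unfolding istopology_def
proof (intro conjI allI impI)
  fix S T assume ST: "test_open S" "test_open T"
  show "test_open (S \<inter> T)"
    unfolding test_open_def
  proof (intro conjI ballI)
    show "S \<inter> T \<subseteq> test_functions" using ST by (auto simp: test_open_def)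
    fix f assume f: "f \<in> S \<inter> T"
    obtain V where V: "basic_zero_nhd V" "\<forall>w\<in>V. (\<lambda>t. f t + w t) \<in> S"
      using ST(1) f unfolding test_open_def by blast
    obtain W where W: "basic_zero_nhd W" "\<forall>w\<in>W. (\<lambda>t. f t + w t) \<in> T"
      using ST(2) f unfolding test_open_def by blast
    show "\<exists>W. basic_zero_nhd W \<and> (\<forall>w\<in>W. (\<lambda>t. f t + w t) \<in> S \<inter> T)"
      using V W basic_zero_nhd_Int[OF V(1) W(1)] by blast
  qed
next
  fix \<K> assume "\<forall>K\<in>\<K>. test_open K"
  then show "test_open (\<Union>\<K>)"
    unfolding test_open_def by (meson Union_iff Sup_le_iff)
qed

lemma openin_test_topology: "openin test_topology U \<longleftrightarrow> test_open U"
  by (simp add: test_topology_def topology_inverse' istopology_test_open)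

subsection \<open>Laplace transform and the space \<open>\<Y>\<close>\<close>

definition laplace :: "(real \<Rightarrow> complex) \<Rightarrow> complex \<Rightarrow> complex" where
  "laplace f = (\<lambda>z. LINT t:{0<..}|lborel. exp (- (of_real t * z)) * f t)"

definition laplace_space :: "(complex \<Rightarrow> complex) set" where
  "laplace_space = {g. g holomorphic_on UNIV \<and>
     (\<exists>rp rm :: real. rp < 0 \<and>
       (\<forall>n::nat. \<exists>C::real. \<forall>z.
          (Re z \<ge> 0 \<longrightarrow> norm (g z) \<le> C / (1 + norm z) ^ n * exp (rp * \<bar>Re z\<bar>)) \<and>
          (Re z \<le> 0 \<longrightarrow> norm (g z) \<le> C / (1 + norm z) ^ n * exp (rm * \<bar>Re z\<bar>))))}"

text \<open>
  By Paley--Wiener \<^const>\<open>laplace\<close> maps \<^const>\<open>test_functions\<close> bijectively onto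
  \<^const>\<open>laplace_space\<close>; the topology making it an isomorphism is the one pulled back along
  the inverse.
\<close>

definition laplace_space_topology :: "(complex \<Rightarrow> complex) topology" where
  "laplace_space_topology =
     pullback_topology laplace_space (inv_into test_functions laplace) test_topology"

subsection \<open>Dual spaces and the sigma-function\<close>

text \<open>
  The pairing \<open>\<langle>u, f\<rangle>\<close> is written \<open>u f\<close>. As it is antilinear in \<open>f\<close>, the elements of the dual
  are the continuous antilinear functionals. They are made \<^const>\<open>extensional\<close> so that
  functionals that agree on the space are equal.
\<close>

definition antilinear_on :: "('a \<Rightarrow> complex) set \<Rightarrow> (('a \<Rightarrow> complex) \<Rightarrow> complex) \<Rightarrow> bool" where
  "antilinear_on X u \<longleftrightarrow>
     (\<forall>f\<in>X. \<forall>g\<in>X. \<forall>a b :: complex. u (\<lambda>x. a * f x + b * g x) = cnj a * u f + cnj b * u g)"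

definition dual_space :: "('a \<Rightarrow> complex) topology \<Rightarrow> (('a \<Rightarrow> complex) \<Rightarrow> complex) set" where
  "dual_space T = {u \<in> extensional (topspace T).
     antilinear_on (topspace T) u \<and> continuous_map T euclidean u}"

definition laplace_adjoint ::
    "((complex \<Rightarrow> complex) \<Rightarrow> complex) \<Rightarrow> (real \<Rightarrow> complex) \<Rightarrow> complex" where
  "laplace_adjoint \<sigma> = (\<lambda>f\<in>test_functions. \<sigma> (laplace f))"

definition sigma_function ::
    "((real \<Rightarrow> complex) \<Rightarrow> complex) \<Rightarrow> (complex \<Rightarrow> complex) \<Rightarrow> complex" where
  "sigma_function h = inv_into (dual_space laplace_space_topology) laplace_adjoint h"

definition laplace_star :: "(complex \<Rightarrow> complex) \<Rightarrow> complex \<Rightarrow> complex" where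
  "laplace_star g = (\<lambda>z. cnj (g (cnj z)))"

definition laplace_conv :: "(real \<Rightarrow> complex) \<Rightarrow> (real \<Rightarrow> complex) \<Rightarrow> real \<Rightarrow> complex" where
  "laplace_conv u v = (\<lambda>t. LINT s:{0<..}|lborel. u s * v (t - s))"

end

theory Submission
  imports Defs "HOL-Probability.Sinc_Integral" "HOL-Probability.Characteristic_Functions"
begin

text \<open>
  Since \<open>L (u \<star> v) = L u \<cdot> L v\<close> and \<open>(L f\<^sub>1)\<^sup>* = L (cnj f\<^sub>1)\<close>, the identity is the defining
  relation \<open>\<langle>h, f\<rangle> = \<langle>\<sigma>, L f\<rangle>\<close> at \<open>f = cnj f\<^sub>1 \<star> f\<^sub>2\<close>. That \<open>\<sigma>\<close> satisfies this relation needs the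
  Paley--Wiener theorem: \<open>L\<close> is a bijection, so \<open>h \<circ> L\<^sup>-\<^sup>1\<close> is a preimage of \<open>h\<close> under the adjoint.
  Injectivity follows from the Weierstrass theorem in the variable \<open>e\<^sup>-\<^sup>t\<close>. For surjectivity, put
  \<open>f(t) = (1/2\<pi>) \<integral> g(iy) e\<^sup>i\<^sup>t\<^sup>y dy\<close>; pushing the line of integration to \<open>\<plusminus>\<infinity>\<close> bounds its
  support, and \<open>L f = g\<close> comes from integrating in \<open>t\<close> first, which leaves the kernel
  \<open>1 / (w - z)\<close>, so that the Cauchy integral formula applies.
\<close>

subsection \<open>Integrals along vertical lines\<close>

text \<open>\<open>sigma_function\<close> chooses with \<open>inv_into\<close>, so its value is
  unspecified until h is known to lie in the range of the adjoint; that is what forces the work on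
  the Laplace transform. Continuity of the preimage comes from the topology of the target being
  transported along L^-1. On Re w = c the integrand of f(t) has size exp (c (t + rp)) for c \<ge> 0
  and exp (- c (rm - t)) for c \<le> 0. Hence the right end kills f at t < - rp, the left end at t >
  rm, and rp < 0 keeps the support away from 0. Integrating exp (t (w - z)) over 0 \<le> t \<le> b
  yields two terms, exp (b (w - z)) / (w - z) and - 1 / (w - z), on a line to the right of z. They
  vanish in opposite directions: the second when the line moves right, the first, for b > rm, when
  it moves left. Only the latter crosses w = z, and its residue is g z. Contour theorems concern
  bounded curves, so each shift needs decay along the lines.\<close>

lemma integrable_inverse_1_plus_square_lborel: "integrable lborel (\<lambda>y::real. 1 / (1 + y\<^sup>2))"
  using integrable_inverse_1_plus_square
  by (simp add: set_integrable_def einterval_def inverse_eq_divide)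

text \<open>Decay along a line is recorded throughout in the form
  \<open>M / (1 + y\<^sup>2)\<close>. The integral of \<open>1 / (1 + y\<^sup>2)\<close> stays
  symbolic, since it enters only as a constant factor.\<close>

lemma
  fixes f :: "real \<Rightarrow> complex"
  assumes cont: "continuous_on UNIV f" and bd: "\<And>y. norm (f y) \<le> M / (1 + y\<^sup>2)"
  shows integrable_quadratic_decay: "integrable lborel f"
    and norm_integral_quadratic_decay:
      "norm (LINT y|lborel. f y) \<le> M * (LINT y|lborel. 1 / (1 + y\<^sup>2))"
proof -
  have i: "integrable lborel (\<lambda>y::real. M * (1 / (1 + y\<^sup>2)))"
    by (intro integrable_mult_right integrable_inverse_1_plus_square_lborel)
  show f: "integrable lborel f"
    by (rule Bochner_Integration.integrable_bound[OF i])
       (use order_trans[OF bd abs_ge_self] cont in \<open>auto simp: abs_mult intro!: AE_I2 borel_measurable_continuous_onI\<close>)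
  have "norm (LINT y|lborel. f y) \<le> (LINT y|lborel. M * (1 / (1 + y\<^sup>2)))"
    by (rule Bochner_Integration.integral_norm_bound_integral[OF f i]) (use bd in auto)
  then show "norm (LINT y|lborel. f y) \<le> M * (LINT y|lborel. 1 / (1 + y\<^sup>2))"
    unfolding integral_mult_right_zero .
qed

text \<open>Contour integrals see bounded segments; this passes to the whole line by dominated
  convergence with majorant \<open>norm f\<close>.\<close>

lemma integral_symmetric_tendsto:
  fixes f :: "real \<Rightarrow> complex"
  assumes "integrable lborel f"
  shows "(\<lambda>n. integral {- real n..real n} f) \<longlonglongrightarrow> (LINT y|lborel. f y)"
proof -
  have si: "set_integrable lborel {- real n..real n} f" for n
    using assms by (auto simp: set_integrable_def intro: integrable_mult_indicator)
  have "(\<lambda>n. LINT y|lborel. indicator {- real n..real n} y *\<^sub>R f y) \<longlonglongrightarrow> (LINT y|lborel. f y)"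
  proof (rule integral_dominated_convergence[where w="\<lambda>y. norm (f y)"])
    show "AE x in lborel. (\<lambda>n. indicator {- real n..real n} x *\<^sub>R f x) \<longlonglongrightarrow> f x"
    proof (rule AE_I2)
      fix x :: real
      obtain N :: nat where "\<bar>x\<bar> \<le> real N" using real_arch_simple by blast
      then have "eventually (\<lambda>n. indicator {- real n..real n} x *\<^sub>R f x = f x) sequentially"
        by (intro eventually_sequentiallyI[of N]) (auto simp: indicator_def)
      then show "(\<lambda>n. indicator {- real n..real n} x *\<^sub>R f x) \<longlonglongrightarrow> f x"
        by (rule tendsto_eventually)
    qed
  qed (use assms in \<open>auto simp: indicator_def\<close>)
  then show ?thesis
    using set_borel_integral_eq_integral(2)[OF si] by (simp add: set_lebesgue_integral_def)
qed

text \<open>The integral is against dy, while dw = \<i> dy on a vertical line; hence the factor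
  \<open>\<i>\<close> in every comparison with a contour integral.\<close>

definition vertical_integral :: "(complex \<Rightarrow> complex) \<Rightarrow> real \<Rightarrow> complex" where
  "vertical_integral F c = (LINT y|lborel. F (Complex c y))"

text \<open>The horizontal sides of a rectangle of height 2 T contribute at most 2 (c2 - c1) M / (1
  + T^2), which vanishes as T grows. The bound inside the strip is demanded only for \<bar>y\<bar>
  \<ge> R, which leaves room for a pole; I collects its residue.\<close>

lemma vertical_integral_diff:
  assumes c: "c1 < c2"
    and cont: "\<And>c. c \<in> {c1, c2} \<Longrightarrow> continuous_on UNIV (\<lambda>y. F (Complex c y))"
    and line: "\<And>c y. c \<in> {c1, c2} \<Longrightarrow> norm (F (Complex c y)) \<le> M / (1 + y\<^sup>2)"
    and strip: "\<And>c y. c1 \<le> c \<Longrightarrow> c \<le> c2 \<Longrightarrow> \<bar>y\<bar> \<ge> R \<Longrightarrow> norm (F (Complex c y)) \<le> M / (1 + y\<^sup>2)"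
    and I: "\<And>T. T > R \<Longrightarrow> (F has_contour_integral I) (rectpath (Complex c1 (- T)) (Complex c2 T))"
  shows "\<i> * (vertical_integral F c2 - vertical_integral F c1) = I"
proof -
  have Mpos: "M \<ge> 0"
    using order_trans[OF norm_ge_zero line[of c1 0]] by simp
  have lim: "(\<lambda>n. integral {- real n..real n} (\<lambda>y. F (Complex c y))) \<longlonglongrightarrow> vertical_integral F c"
    if "c \<in> {c1, c2}" for c
    unfolding vertical_integral_def
    by (rule integral_symmetric_tendsto, rule integrable_quadratic_decay[OF cont line]) (use that in auto)
  let ?e = "\<lambda>n. \<i> * (integral {- real n..real n} (\<lambda>y. F (Complex c2 y))
                  - integral {- real n..real n} (\<lambda>y. F (Complex c1 y))) - I"
  obtain N :: nat where N: "max R 0 < real N" using reals_Archimedean2 by blast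
  have est: "norm (?e n) \<le> 2 * (c2 - c1) * M * inverse (real n)" if n: "n \<ge> N" for n
  proof -
    define T where "T = real n"
    have T: "T > R" "T > 0" using N n by (auto simp: T_def)
    define a1 a2 a3 a4 where a: "a1 = Complex c1 (- T)" "a2 = Complex c2 (- T)"
      "a3 = Complex c2 T" "a4 = Complex c1 T"
    let ?p = "linepath a1 a2 +++ linepath a2 a3 +++ linepath a3 a4 +++ linepath a4 a1"
    have p: "(F has_contour_integral I) ?p"
      using I[OF T(1)] by (simp add: rectpath_def Let_def a)
    have "F contour_integrable_on ?p" using p by (auto simp: contour_integrable_on_def)
    then have ci: "F contour_integrable_on linepath a1 a2" "F contour_integrable_on linepath a2 a3"
      "F contour_integrable_on linepath a3 a4" "F contour_integrable_on linepath a4 a1"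
      by simp_all
    have sum: "I = contour_integral (linepath a1 a2) F + contour_integral (linepath a2 a3) F
        + contour_integral (linepath a3 a4) F + contour_integral (linepath a4 a1) F"
      using contour_integral_unique[OF p] ci by (simp add: add.assoc)
    have r: "contour_integral (linepath a2 a3) F = \<i> * integral {- T..T} (\<lambda>y. F (Complex c2 y))"
      by (rule contour_integral_linepath_same_Re) (use T in \<open>auto simp: a\<close>)
    have "contour_integral (linepath a4 a1) F = - contour_integral (linepath a1 a4) F"
      using contour_integral_reversepath[of "linepath a1 a4" F] by simp
    also have "contour_integral (linepath a1 a4) F = \<i> * integral {- T..T} (\<lambda>y. F (Complex c1 y))"
      by (rule contour_integral_linepath_same_Re) (use T in \<open>auto simp: a\<close>)
    finally have l: "contour_integral (linepath a4 a1) F = - (\<i> * integral {- T..T} (\<lambda>y. F (Complex c1 y)))" .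
    have hor: "norm (contour_integral (linepath a b) F) \<le> M / (1 + T\<^sup>2) * (c2 - c1)"
      if "F contour_integrable_on linepath a b" "norm (b - a) = c2 - c1"
        "\<And>w. w \<in> closed_segment a b \<Longrightarrow> c1 \<le> Re w \<and> Re w \<le> c2 \<and> \<bar>Im w\<bar> = T" for a b
    proof -
      have "norm (contour_integral (linepath a b) F) \<le> M / (1 + T\<^sup>2) * norm (b - a)"
      proof (rule contour_integral_bound_linepath[OF that(1)])
        show "M / (1 + T\<^sup>2) \<ge> 0" using Mpos by (auto intro!: divide_nonneg_nonneg)
        fix w assume "w \<in> closed_segment a b"
        then have w: "c1 \<le> Re w" "Re w \<le> c2" "\<bar>Im w\<bar> = T" using that(3) by auto
        have "(Im w)\<^sup>2 = T\<^sup>2" using w(3) by (metis power2_abs)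
        then show "norm (F w) \<le> M / (1 + T\<^sup>2)"
          using strip[OF w(1,2), of "Im w"] w(3) T by (simp add: complex_eq_iff)
      qed
      then show ?thesis using that(2) by simp
    qed
    have h1: "norm (contour_integral (linepath a1 a2) F) \<le> M / (1 + T\<^sup>2) * (c2 - c1)"
    proof (rule hor[OF ci(1)])
      have "a2 - a1 = of_real (c2 - c1)" by (simp add: a complex_eq_iff)
      then show "norm (a2 - a1) = c2 - c1" using c by (simp only: norm_of_real) 
    qed (use c T in \<open>auto simp: a closed_segment_same_Im closed_segment_eq_real_ivl\<close>)
    have h2: "norm (contour_integral (linepath a3 a4) F) \<le> M / (1 + T\<^sup>2) * (c2 - c1)"
    proof (rule hor[OF ci(3)])
      have "a4 - a3 = of_real (c1 - c2)" by (simp add: a complex_eq_iff)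
      then show "norm (a4 - a3) = c2 - c1" using c by (simp only: norm_of_real) 
    qed (use c T in \<open>auto simp: a closed_segment_same_Im closed_segment_eq_real_ivl\<close>)
    \<comment> \<open>Subtracting I cancels the vertical sides; the horizontal ones remain with
      reversed sign.\<close>
    have "?e n = - contour_integral (linepath a1 a2) F - contour_integral (linepath a3 a4) F"
      unfolding sum r l T_def[symmetric] by (simp add: algebra_simps)
    then have "norm (?e n) \<le> norm (contour_integral (linepath a1 a2) F) + norm (contour_integral (linepath a3 a4) F)"
      by (metis norm_minus_cancel norm_triangle_ineq4)
    also have "\<dots> \<le> 2 * (M / (1 + T\<^sup>2) * (c2 - c1))" using h1 h2 by linarith
    also have "\<dots> = 2 * (c2 - c1) * M * (1 / (1 + T\<^sup>2))" by simp
    also have "\<dots> \<le> 2 * (c2 - c1) * M * inverse T"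
    proof (rule mult_left_mono)
      have "T * 2 \<le> 1 + T\<^sup>2" using sum_squares_bound[of T 1] by simp
      then show "1 / (1 + T\<^sup>2) \<le> inverse T" using T by (simp add: inverse_eq_divide frac_le)
    qed (use c Mpos in auto)
    finally show ?thesis by (simp add: T_def)
  qed
  have "?e \<longlonglongrightarrow> 0"
  proof (rule Lim_null_comparison)
    show "\<forall>\<^sub>F n in sequentially. norm (?e n) \<le> 2 * (c2 - c1) * M * inverse (real n)"
      using est by (rule eventually_sequentiallyI)
    show "(\<lambda>n. 2 * (c2 - c1) * M * inverse (real n)) \<longlonglongrightarrow> 0"
      by (rule tendsto_mult_right_zero) (rule lim_inverse_n)
  qed
  moreover have "?e \<longlonglongrightarrow> \<i> * (vertical_integral F c2 - vertical_integral F c1) - I"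
    by (intro tendsto_intros lim) auto
  ultimately show ?thesis using LIMSEQ_unique by fastforce
qed

lemma continuous_on_Complex_line:
  assumes "continuous_on S F" "\<And>y. Complex c y \<in> S"
  shows "continuous_on UNIV (\<lambda>y. F (Complex c y))"
proof (rule continuous_on_compose2[OF assms(1)])
  show "continuous_on UNIV (Complex c)" unfolding Complex_eq by (intro continuous_intros)
qed (use assms in auto)

lemma vertical_integral_shift:
  assumes hol: "F holomorphic_on UNIV" and c: "c1 \<le> c2"
    and strip: "\<And>c y. c1 \<le> c \<Longrightarrow> c \<le> c2 \<Longrightarrow> norm (F (Complex c y)) \<le> M / (1 + y\<^sup>2)"
  shows "vertical_integral F c1 = vertical_integral F c2"
proof (cases "c1 = c2")
  case False
  have "\<i> * (vertical_integral F c2 - vertical_integral F c1) = 0"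
    by (rule vertical_integral_diff[where M=M and R=0])
       (use c False strip hol in \<open>auto intro!: continuous_on_Complex_line[of UNIV]
          Cauchy_theorem_convex_simple[of _ UNIV] holomorphic_on_imp_continuous_on\<close>)
  then show ?thesis by simp
qed simp

text \<open>The Cauchy integral formula on rectangles around z, in the limit of infinite height.
  Right minus left is the counterclockwise orientation, and the \<i> of 2 pi \<i> is absorbed by
  integrating against dy.\<close>

lemma vertical_integral_residue:
  assumes hol: "G holomorphic_on UNIV" and c: "c1 < Re z" "Re z < c2"
    and strip: "\<And>c y. c1 \<le> c \<Longrightarrow> c \<le> c2 \<Longrightarrow> norm (G (Complex c y)) \<le> M / (1 + y\<^sup>2)"
  shows "vertical_integral (\<lambda>w. G w / (w - z)) c2 - vertical_integral (\<lambda>w. G w / (w - z)) c1 = of_real (2 * pi) * G z"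
proof -
  \<comment> \<open>Both lines stay at distance at least d from z, and so do all points with
    \<bar>y\<bar> \<ge> \<bar>Im z\<bar> + d. There the kernel 1 / (w - z) costs at most a factor 1
    / d.\<close>
  define d where "d = min (Re z - c1) (c2 - Re z)"
  have d: "d > 0" using c by (auto simp: d_def)
  have far: "norm (G (Complex c y) / (Complex c y - z)) \<le> (M / d) / (1 + y\<^sup>2)"
    if "c1 \<le> c" "c \<le> c2" "\<bar>c - Re z\<bar> \<ge> d \<or> \<bar>y - Im z\<bar> \<ge> d" for c y
  proof -
    have "norm (Complex c y - z) \<ge> d"
      using that(3) abs_Re_le_cmod[of "Complex c y - z"] abs_Im_le_cmod[of "Complex c y - z"] by auto
    then have "norm (G (Complex c y)) / norm (Complex c y - z) \<le> (M / (1 + y\<^sup>2)) / d"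
      using strip[OF that(1,2), of y] d by (intro frac_le) (auto intro: order_trans[OF norm_ge_zero])
    then show ?thesis by (simp add: norm_divide mult.commute)
  qed
  have "\<i> * (vertical_integral (\<lambda>w. G w / (w - z)) c2 - vertical_integral (\<lambda>w. G w / (w - z)) c1) = of_real (2 * pi) * \<i> * G z"
  proof (rule vertical_integral_diff[where M="M / d" and R="\<bar>Im z\<bar> + d"])
    fix T assume T: "T > \<bar>Im z\<bar> + d"
    let ?r = "rectpath (Complex c1 (- T)) (Complex c2 T)"
    have box: "z \<in> box (Complex c1 (- T)) (Complex c2 T)"
      using T c d by (auto simp: in_box_complex_iff)
    then have ni: "z \<notin> path_image ?r"
      using path_image_rectpath_inter_box[of "Complex c1 (- T)" "Complex c2 T"] T c d abs_ge_zero[of "Im z"]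
      by (auto simp del: abs_ge_zero)
    show "((\<lambda>w. G w / (w - z)) has_contour_integral of_real (2 * pi) * \<i> * G z) ?r"
      using Cauchy_integral_formula_convex_simple[OF convex_UNIV hol, of z ?r] ni
        winding_number_rectpath[OF box] by (simp add: subset_Diff_insert)
  next
    fix c assume "c \<in> {c1, c2}"
    then show "continuous_on UNIV (\<lambda>y. G (Complex c y) / (Complex c y - z))"
      using c
      by (intro continuous_on_Complex_line[of "- {z}" "\<lambda>w. G w / (w - z)"])
         (auto intro!: holomorphic_on_imp_continuous_on holomorphic_intros holomorphic_on_subset[OF hol])
  next
    fix c y assume "c \<in> {c1, c2}"
    then show "norm (G (Complex c y) / (Complex c y - z)) \<le> M / d / (1 + y\<^sup>2)"
      using c by (intro far) (auto simp: d_def)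
  next
    fix c y assume "c1 \<le> c" "c \<le> c2" "\<bar>y\<bar> \<ge> \<bar>Im z\<bar> + d"
    then show "norm (G (Complex c y) / (Complex c y - z)) \<le> M / d / (1 + y\<^sup>2)"
      by (intro far) auto
  qed (use c in auto)
  then show ?thesis by simp
qed

section \<open>Differentiation of Fourier integrals\<close>

text \<open>Reduces differentiation under the integral sign to one norm estimate of the first-order
  Taylor remainder.\<close>

lemma has_vector_derivative_quadratic_error:
  fixes f :: "real \<Rightarrow> complex"
  assumes "\<And>s. norm (f (t + s) - f t - s *\<^sub>R f') \<le> K * s\<^sup>2"
  shows "(f has_vector_derivative f') (at t)"
  unfolding has_vector_derivative_def has_derivative_at'
proof (intro conjI allI impI)
  show "bounded_linear (\<lambda>x. x *\<^sub>R f')" by (rule bounded_linear_scaleR_left)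
  fix e :: real assume e: "e > 0"
  show "\<exists>d>0. \<forall>x'. 0 < norm (x' - t) \<and> norm (x' - t) < d \<longrightarrow>
        norm (f x' - f t - (x' - t) *\<^sub>R f') / norm (x' - t) < e"
  \<comment> \<open>K has no assumed sign and may be 0; \<bar>K\<bar> + 1 is positive and at least
    K.\<close>
  proof (intro exI[of _ "e / (\<bar>K\<bar> + 1)"] conjI allI impI)
    show "e / (\<bar>K\<bar> + 1) > 0" using e by auto
    fix x assume x: "0 < norm (x - t) \<and> norm (x - t) < e / (\<bar>K\<bar> + 1)"
    have "norm (f x - f t - (x - t) *\<^sub>R f') \<le> K * (x - t)\<^sup>2" using assms[of "x - t"] by simp
    also have "\<dots> \<le> (\<bar>K\<bar> + 1) * (x - t)\<^sup>2" by (intro mult_right_mono) auto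
    also have "\<dots> = ((\<bar>K\<bar> + 1) * norm (x - t)) * norm (x - t)"
      by (simp add: power2_eq_square abs_mult[symmetric])
    also have "\<dots> < e * norm (x - t)"
      using x by (intro mult_strict_right_mono) (auto simp: field_simps)
    finally show "norm (f x - f t - (x - t) *\<^sub>R f') / norm (x - t) < e"
      using x by (auto simp: field_simps)
  qed
qed

text \<open>The remainder \<open>iexp (s * y) - 1 - \<i> * of_real (s * y)\<close> is at most (s
  y)^2 / 2 in modulus, which puts a factor y^2 on G. The squared denominator in the hypothesis pays
  for it and leaves an integrable majorant.\<close>

lemma has_vector_derivative_Fourier_integral:
  assumes cont: "continuous_on UNIV G" and bd: "\<And>y. norm (G y) \<le> M / (1 + y\<^sup>2)\<^sup>2"
  shows "((\<lambda>t. LINT y|lborel. G y * iexp (t * y)) has_vector_derivative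
           (LINT y|lborel. \<i> * of_real y * G y * iexp (t * y))) (at t)"
proof (rule has_vector_derivative_quadratic_error)
  fix s :: real
  \<comment> \<open>The three bounds serve the integral, its derivative and the remainder.\<close>
  have sq: "1 / (1 + y\<^sup>2)\<^sup>2 \<le> 1 / (1 + y\<^sup>2)" "\<bar>y\<bar> * (1 / (1 + y\<^sup>2)\<^sup>2) \<le> 1 / (1 + y\<^sup>2)"
    "y\<^sup>2 * (1 / (1 + y\<^sup>2)\<^sup>2) \<le> 1 / (1 + y\<^sup>2)" for y :: real
  proof -
    have p: "1 + y\<^sup>2 > 0" by (simp add: add_pos_nonneg)
    have e: "1 / (1 + y\<^sup>2) = (1 + y\<^sup>2) * (1 / (1 + y\<^sup>2)\<^sup>2)" using p by (simp add: power2_eq_square)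
    have "\<bar>y\<bar> * 2 \<le> 1 + y\<^sup>2" using sum_squares_bound[of "\<bar>y\<bar>" 1] by simp
    then have "\<bar>y\<bar> \<le> 1 + y\<^sup>2" by simp
    then show "1 / (1 + y\<^sup>2)\<^sup>2 \<le> 1 / (1 + y\<^sup>2)" "\<bar>y\<bar> * (1 / (1 + y\<^sup>2)\<^sup>2) \<le> 1 / (1 + y\<^sup>2)"
      "y\<^sup>2 * (1 / (1 + y\<^sup>2)\<^sup>2) \<le> 1 / (1 + y\<^sup>2)"
      unfolding e using mult_right_mono[of _ "1 + y\<^sup>2" "1 / (1 + y\<^sup>2)\<^sup>2"]
      by (fastforce simp: mult.commute)+
  qed
  have M: "M \<ge> 0" using order_trans[OF norm_ge_zero bd[of 0]] by simp
  have bd1: "norm (G y) \<le> M / (1 + y\<^sup>2)" for y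
    using order_trans[OF bd[of y]] mult_left_mono[OF sq(1)[of y] M] by simp
  have bd2: "\<bar>y\<bar> * norm (G y) \<le> M / (1 + y\<^sup>2)" for y
    using order_trans[OF mult_left_mono[OF bd[of y], of "\<bar>y\<bar>"]] mult_left_mono[OF sq(2)[of y] M]
    by (simp add: mult_ac)
  have bd3: "y\<^sup>2 * norm (G y) \<le> M / (1 + y\<^sup>2)" for y
    using order_trans[OF mult_left_mono[OF bd[of y], of "y\<^sup>2"]] mult_left_mono[OF sq(3)[of y] M]
    by (simp add: mult_ac)
  have i1: "integrable lborel (\<lambda>y. G y * iexp (t * y))" for t :: real
    by (rule integrable_quadratic_decay[where M=M])
       (use bd1 cont in \<open>auto simp: norm_mult intro!: continuous_intros\<close>)
  have i2: "integrable lborel (\<lambda>y. \<i> * of_real y * G y * iexp (t * y))"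
    by (rule integrable_quadratic_decay[where M=M])
       (use bd2 cont in \<open>auto simp: norm_mult intro!: continuous_intros\<close>)
  let ?E = "\<lambda>y. G y * iexp (t * y) * (iexp (s * y) - 1 - \<i> * of_real (s * y))"
  have "(LINT y|lborel. G y * iexp ((t + s) * y)) - (LINT y|lborel. G y * iexp (t * y))
        - s *\<^sub>R (LINT y|lborel. \<i> * of_real y * G y * iexp (t * y)) =
        (LINT y|lborel. G y * iexp ((t + s) * y) - G y * iexp (t * y)
           - s *\<^sub>R (\<i> * of_real y * G y * iexp (t * y)))"
    by (simp only: Bochner_Integration.integral_diff[OF Bochner_Integration.integrable_diff[OF i1 i1]
          integrable_scaleR_right[OF i2]] Bochner_Integration.integral_diff[OF i1 i1] integral_scaleR_right)
  also have "\<dots> = (LINT y|lborel. ?E y)"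
    by (intro Bochner_Integration.integral_cong refl)
       (simp add: scaleR_conv_of_real algebra_simps exp_add[symmetric])
  also have "norm \<dots> \<le> M * s\<^sup>2 * (LINT y|lborel. 1 / (1 + y\<^sup>2))"
  proof (rule norm_integral_quadratic_decay)
    show "continuous_on UNIV ?E" using cont by (auto intro!: continuous_intros)
    fix y :: real
    have "norm (iexp (s * y) - 1 - \<i> * of_real (s * y)) \<le> (s * y)\<^sup>2 / 2"
      using iexp_approx1[of "s * y" 1] by (simp add: power2_eq_square algebra_simps abs_mult)
    also have "\<dots> \<le> s\<^sup>2 * y\<^sup>2" by (simp add: power_mult_distrib)
    finally have "norm (?E y) \<le> norm (G y) * (s\<^sup>2 * y\<^sup>2)"
      by (simp add: norm_mult mult_left_mono)
    also have "\<dots> = s\<^sup>2 * (y\<^sup>2 * norm (G y))" by simp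
    also have "\<dots> \<le> s\<^sup>2 * (M / (1 + y\<^sup>2))" by (intro mult_left_mono bd3) auto
    finally show "norm (?E y) \<le> M * s\<^sup>2 / (1 + y\<^sup>2)" by (simp add: mult.commute)
  qed
  finally show "norm ((LINT y|lborel. G y * iexp ((t + s) * y)) - (LINT y|lborel. G y * iexp (t * y))
        - s *\<^sub>R (LINT y|lborel. \<i> * of_real y * G y * iexp (t * y)))
        \<le> M * (LINT y|lborel. 1 / (1 + y\<^sup>2)) * s\<^sup>2" by (simp add: mult_ac)
qed

subsection \<open>The inverse Laplace transform\<close>

text \<open>Both half-plane bounds of \<open>laplace_space\<close> as one weight in c = Re z; to the
  left \<bar>c\<bar> = - c, whence the sign in front of \<open>rm\<close>.\<close>

definition laplace_growth :: "real \<Rightarrow> real \<Rightarrow> real \<Rightarrow> real" where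
  "laplace_growth rp rm c = exp (if c \<ge> 0 then rp * c else - rm * c)"

lemma laplace_spaceE:
  assumes "g \<in> laplace_space"
  obtains rp rm where "rp < 0"
    and "\<And>n. \<exists>C\<ge>0. \<forall>z. norm (g z) * (1 + norm z) ^ n \<le> C * laplace_growth rp rm (Re z)"
proof -
  from assms obtain rp rm where rp: "rp < 0" and
    b: "\<And>n. \<exists>C. \<forall>z. (Re z \<ge> 0 \<longrightarrow> norm (g z) \<le> C / (1 + norm z) ^ n * exp (rp * \<bar>Re z\<bar>)) \<and>
          (Re z \<le> 0 \<longrightarrow> norm (g z) \<le> C / (1 + norm z) ^ n * exp (rm * \<bar>Re z\<bar>))"
    unfolding laplace_space_def by blast
  have "\<exists>C\<ge>0. \<forall>z. norm (g z) * (1 + norm z) ^ n \<le> C * laplace_growth rp rm (Re z)" for n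
  proof -
    obtain C where C: "\<And>z. Re z \<ge> 0 \<Longrightarrow> norm (g z) \<le> C / (1 + norm z) ^ n * exp (rp * \<bar>Re z\<bar>)"
      "\<And>z. Re z \<le> 0 \<Longrightarrow> norm (g z) \<le> C / (1 + norm z) ^ n * exp (rm * \<bar>Re z\<bar>)"
      using b[of n] by blast
    have "C \<ge> 0" using order_trans[OF norm_ge_zero C(1)[of 0]] by simp
    moreover have "norm (g z) * (1 + norm z) ^ n \<le> C * laplace_growth rp rm (Re z)" for z
    proof -
      have p: "(1 + norm z) ^ n > 0" by (simp add: add_pos_nonneg)
      have "norm (g z) \<le> C / (1 + norm z) ^ n * laplace_growth rp rm (Re z)"
        using C[of z] by (auto simp: laplace_growth_def)
      then show ?thesis using p by (simp add: field_simps)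
    qed
    ultimately show ?thesis by blast
  qed
  then show ?thesis using that rp by blast
qed

lemma laplace_space_entire: "g \<in> laplace_space \<Longrightarrow> g holomorphic_on UNIV"
  by (simp add: laplace_space_def)

text \<open>Decay of order 4 gives both bounds, as (1 + |w|)^4 \<ge> (1 + y^2)^2 on the line. The
  stronger one is for differentiation in t, the weaker for contour shifts.\<close>

lemma laplace_space_bound_lines:
  assumes "g \<in> laplace_space"
  shows "\<exists>rp rm C. rp < 0 \<and> C \<ge> 0 \<and>
    (\<forall>c y. norm (g (Complex c y)) \<le> C * laplace_growth rp rm c / (1 + y\<^sup>2)\<^sup>2) \<and>
    (\<forall>c y. norm (g (Complex c y)) \<le> C * laplace_growth rp rm c / (1 + y\<^sup>2))"
proof -
  obtain rp rm where r: "rp < 0" and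
    b: "\<And>n. \<exists>C\<ge>0. \<forall>z. norm (g z) * (1 + norm z) ^ n \<le> C * laplace_growth rp rm (Re z)"
    using laplace_spaceE[OF assms] by blast
  obtain C where C: "C \<ge> 0" "\<And>z. norm (g z) * (1 + norm z) ^ 4 \<le> C * laplace_growth rp rm (Re z)"
    using b[of 4] by blast
  have *: "norm (g (Complex c y)) \<le> C * laplace_growth rp rm c / (1 + y\<^sup>2)\<^sup>2" for c y
  proof -
    have "1 + y\<^sup>2 \<le> (1 + \<bar>y\<bar>)\<^sup>2" by (simp add: power2_sum)
    also have "\<dots> \<le> (1 + norm (Complex c y))\<^sup>2"
      using abs_Im_le_cmod[of "Complex c y"] by (intro power_mono) auto
    finally have "(1 + y\<^sup>2)\<^sup>2 \<le> ((1 + norm (Complex c y))\<^sup>2)\<^sup>2" by (intro power_mono) auto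
    then have "norm (g (Complex c y)) * (1 + y\<^sup>2)\<^sup>2 \<le> norm (g (Complex c y)) * (1 + norm (Complex c y)) ^ 4"
      by (intro mult_left_mono) (auto simp: power_mult[symmetric])
    also have "\<dots> \<le> C * laplace_growth rp rm c" using C(2)[of "Complex c y"] by simp
    finally have le: "norm (g (Complex c y)) * (1 + y\<^sup>2)\<^sup>2 \<le> C * laplace_growth rp rm c" .
    have "(1 + y\<^sup>2)\<^sup>2 > 0" by (intro zero_less_power add_pos_nonneg) auto
    then show ?thesis using le by (simp only: pos_le_divide_eq)
  qed
  moreover have "norm (g (Complex c y)) \<le> C * laplace_growth rp rm c / (1 + y\<^sup>2)" for c y
  proof (rule order_trans[OF *])
    have p: "1 + y\<^sup>2 > 0" by (intro add_pos_nonneg) auto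
    have "1 + y\<^sup>2 \<le> (1 + y\<^sup>2)\<^sup>2" using power_increasing[of 1 2 "1 + y\<^sup>2"] by simp
    then show "C * laplace_growth rp rm c / (1 + y\<^sup>2)\<^sup>2 \<le> C * laplace_growth rp rm c / (1 + y\<^sup>2)"
      using C(1) p by (intro divide_left_mono mult_nonneg_nonneg mult_pos_pos zero_less_power)
        (auto simp only: laplace_growth_def exp_ge_zero)
  qed
  ultimately show ?thesis using r C(1) by blast
qed

text \<open>The bound of order n + 1 for g gives order n after multiplication by z. Multiplication
  by z corresponds to d/dt, so this closure drives the smoothness proof.\<close>

lemma laplace_space_mult_ident:
  assumes "g \<in> laplace_space"
  shows "(\<lambda>z. z * g z) \<in> laplace_space"
proof -
  obtain rp rm :: real where r: "rp < 0" and
    b: "\<And>n. \<exists>C. \<forall>z. (Re z \<ge> 0 \<longrightarrow> norm (g z) \<le> C / (1 + norm z) ^ n * exp (rp * \<bar>Re z\<bar>)) \<and>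
          (Re z \<le> 0 \<longrightarrow> norm (g z) \<le> C / (1 + norm z) ^ n * exp (rm * \<bar>Re z\<bar>))"
    using assms unfolding laplace_space_def by blast
  have step: "norm (z * g z) \<le> C / (1 + norm z) ^ n * e"
    if "norm (g z) \<le> C / (1 + norm z) ^ Suc n * e" for z :: complex and C e :: real and n
  proof -
    have "norm (z * g z) \<le> (1 + norm z) * norm (g z)"
      by (simp add: norm_mult mult_right_mono)
    also have "\<dots> \<le> (1 + norm z) * (C / (1 + norm z) ^ Suc n * e)"
      by (rule mult_left_mono[OF that]) simp
    also have "\<dots> = C / (1 + norm z) ^ n * e"
    proof -
      have "1 + norm z \<noteq> 0" using norm_ge_zero[of z] by linarith
      then show ?thesis by simp
    qed
    finally show ?thesis .
  qed
  have "\<exists>C. \<forall>z. (Re z \<ge> 0 \<longrightarrow> norm (z * g z) \<le> C / (1 + norm z) ^ n * exp (rp * \<bar>Re z\<bar>)) \<and>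
          (Re z \<le> 0 \<longrightarrow> norm (z * g z) \<le> C / (1 + norm z) ^ n * exp (rm * \<bar>Re z\<bar>))" for n
    using b[of "Suc n"] step by blast
  moreover have "(\<lambda>z. z * g z) holomorphic_on UNIV"
    using laplace_space_entire[OF assms] by (intro holomorphic_intros)
  ultimately show ?thesis using r unfolding laplace_space_def by blast
qed

text \<open>On the line, exp (t (w - z)) is the scalar exp (t (c - z)) times
  \<open>iexp (t * y)\<close>, so the product rule applies to a scalar and a Fourier integral. With
  z = 0 and F = g this differentiates \<open>inv_laplace\<close>; with g w / (w - z) for F it yields
  a primitive of the integrand of the transform.\<close>

lemma has_vector_derivative_vertical_integral_exp:
  assumes cont: "continuous_on UNIV (\<lambda>y. F (Complex c y))"
    and bd: "\<And>y. norm (F (Complex c y)) \<le> M / (1 + y\<^sup>2)\<^sup>2"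
  shows "((\<lambda>t. vertical_integral (\<lambda>w. F w * exp (of_real t * (w - z))) c) has_vector_derivative
           vertical_integral (\<lambda>w. (w - z) * F w * exp (of_real t * (w - z))) c) (at t)"
proof -
  let ?G = "\<lambda>y. F (Complex c y)"
  let ?e = "\<lambda>t. exp (of_real t * (of_real c - z))"
  let ?I = "\<lambda>t. LINT y|lborel. ?G y * iexp (t * y)"
  let ?D = "LINT y|lborel. \<i> * of_real y * ?G y * iexp (t * y)"
  have M: "M \<ge> 0" using order_trans[OF norm_ge_zero bd[of 0]] by simp
  have exp: "exp (of_real t * (Complex c y - z)) = ?e t * iexp (t * y)" for t y
    by (simp add: Complex_eq algebra_simps exp_add[symmetric])
  have bd1: "norm (?G y) \<le> M / (1 + y\<^sup>2)" "norm (of_real y * ?G y) \<le> M / (1 + y\<^sup>2)" for y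
  proof -
    have p: "1 + y\<^sup>2 > 0" by (simp add: add_pos_nonneg)
    have q: "M / (1 + y\<^sup>2)\<^sup>2 * (1 + y\<^sup>2) = M / (1 + y\<^sup>2)" using p by (simp add: power2_eq_square)
    have n: "M / (1 + y\<^sup>2)\<^sup>2 \<ge> 0" using M by simp
    show "norm (?G y) \<le> M / (1 + y\<^sup>2)"
      using order_trans[OF bd[of y]] mult_left_mono[OF _ n, of 1 "1 + y\<^sup>2"] q by simp
    have "\<bar>y\<bar> * 2 \<le> 1 + y\<^sup>2" using sum_squares_bound[of "\<bar>y\<bar>" 1] by simp
    then have "\<bar>y\<bar> * norm (?G y) \<le> (1 + y\<^sup>2) * (M / (1 + y\<^sup>2)\<^sup>2)"
      using bd[of y] by (intro mult_mono) auto
    then show "norm (of_real y * ?G y) \<le> M / (1 + y\<^sup>2)"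
      using q by (simp add: norm_mult mult.commute)
  qed
  have i1: "integrable lborel (\<lambda>y. ?G y * iexp (t * y))"
    by (rule integrable_quadratic_decay[where M=M])
       (use bd1 cont in \<open>auto simp: norm_mult intro!: continuous_intros\<close>)
  have i2: "integrable lborel (\<lambda>y. \<i> * of_real y * ?G y * iexp (t * y))"
    by (rule integrable_quadratic_decay[where M=M])
       (use bd1 cont in \<open>auto simp: norm_mult intro!: continuous_intros\<close>)
  have V: "(\<lambda>t. vertical_integral (\<lambda>w. F w * exp (of_real t * (w - z))) c) = (\<lambda>t. ?e t * ?I t)"
    unfolding vertical_integral_def exp
    by (simp only: mult.left_commute[of _ "?e _"] integral_mult_right_zero)
  have "vertical_integral (\<lambda>w. (w - z) * F w * exp (of_real t * (w - z))) c =
      (LINT y|lborel. ?e t * ((of_real c - z) * (?G y * iexp (t * y)) + \<i> * of_real y * ?G y * iexp (t * y)))"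
    unfolding vertical_integral_def exp
    by (intro Bochner_Integration.integral_cong refl) (simp add: Complex_eq algebra_simps)
  also have "\<dots> = ?e t * ((of_real c - z) * ?I t + ?D)"
    by (simp only: integral_mult_right_zero
          Bochner_Integration.integral_add[OF integrable_mult_right[OF i1] i2])
  finally have D: "vertical_integral (\<lambda>w. (w - z) * F w * exp (of_real t * (w - z))) c
      = ?e t * ((of_real c - z) * ?I t + ?D)" .
  have e: "(?e has_vector_derivative (of_real c - z) * ?e t) (at t)"
    by (rule has_vector_derivative_eq_rhs, rule has_vector_derivative_real_field)
       (auto intro!: derivative_eq_intros)
  have "((\<lambda>t. ?e t * ?I t) has_vector_derivative ?e t * ?D + (of_real c - z) * ?e t * ?I t) (at t)"
    by (rule has_vector_derivative_mult[OF e has_vector_derivative_Fourier_integral[OF cont bd]])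
  then show ?thesis unfolding V D by (simp add: algebra_simps)
qed

text \<open>The Bromwich integral on the imaginary axis, dy / (2 pi) being dw / (2 pi \<i>). For g
  in \<open>laplace_space\<close> every vertical line gives the same value.\<close>

definition inv_laplace :: "(complex \<Rightarrow> complex) \<Rightarrow> real \<Rightarrow> complex" where
  "inv_laplace g t = vertical_integral (\<lambda>w. g w * exp (of_real t * w)) 0 / of_real (2 * pi)"

lemma continuous_on_laplace_space_line:
  "g \<in> laplace_space \<Longrightarrow> continuous_on UNIV (\<lambda>y. g (Complex c y))"
  by (rule continuous_on_Complex_line[of UNIV])
     (auto intro!: holomorphic_on_imp_continuous_on laplace_space_entire)

lemma inv_laplace_has_vector_derivative:
  assumes "g \<in> laplace_space"
  shows "(inv_laplace g has_vector_derivative inv_laplace (\<lambda>z. z * g z) t) (at t)"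
proof -
  obtain rp C rm :: real where "rp < 0" "C \<ge> 0" and b: "\<And>c y. norm (g (Complex c y)) \<le> C * laplace_growth rp rm c / (1 + y\<^sup>2)\<^sup>2"
    using laplace_space_bound_lines[OF assms] by metis
  have "((\<lambda>t. vertical_integral (\<lambda>w. g w * exp (of_real t * (w - 0))) 0) has_vector_derivative
           vertical_integral (\<lambda>w. (w - 0) * g w * exp (of_real t * (w - 0))) 0) (at t)"
    by (rule has_vector_derivative_vertical_integral_exp[OF continuous_on_laplace_space_line[OF assms] b])
  then show ?thesis
    unfolding inv_laplace_def[abs_def] diff_zero by (rule has_vector_derivative_divide)
qed

lemma nth_deriv_0 [simp]: "nth_deriv 0 f = f"
  by (simp add: nth_deriv_def)

lemma nth_deriv_Suc: "nth_deriv (Suc n) f = (\<lambda>t. vector_derivative (nth_deriv n f) (at t))"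
  by (simp add: nth_deriv_def)

text \<open>Every derivative is again an inverse transform of some member of the space, and all such
  are differentiable.\<close>

lemma smooth_inv_laplace:
  assumes "g \<in> laplace_space"
  shows "smooth (inv_laplace g)"
proof -
  have "\<exists>g'\<in>laplace_space. nth_deriv n (inv_laplace g) = inv_laplace g'" for n
  proof (induction n)
    case 0
    then show ?case using assms by auto
  next
    case (Suc n)
    then obtain g' where g': "g' \<in> laplace_space" "nth_deriv n (inv_laplace g) = inv_laplace g'" by auto
    have "nth_deriv (Suc n) (inv_laplace g) = inv_laplace (\<lambda>z. z * g' z)"
      using inv_laplace_has_vector_derivative[OF g'(1)]
      by (auto simp: nth_deriv_Suc g'(2) intro!: ext vector_derivative_at)
    then show ?case using laplace_space_mult_ident[OF g'(1)] by blast
  qed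
  then show ?thesis
    unfolding smooth_def using inv_laplace_has_vector_derivative
    by (metis differentiableI_vector)
qed

section \<open>Contour shifts, support and inversion\<close>

text \<open>This is how a line is pushed to infinity: v does not depend on the line, while its bound
  on the line at distance s decays in s.\<close>

lemma eq_0_if_norm_le_exp_decay:
  fixes v :: complex
  assumes "d > 0" "\<And>s. s \<ge> s0 \<Longrightarrow> norm v \<le> K * exp (- (d * s))"
  shows "v = 0"
proof -
  have "((\<lambda>s. K * exp (- (d * s))) \<longlongrightarrow> K * 0) at_top"
    by (intro tendsto_mult tendsto_const filterlim_compose[OF exp_at_bot]
         filterlim_compose[OF filterlim_uminus_at_bot_at_top]
         filterlim_tendsto_pos_mult_at_top[OF tendsto_const assms(1)] filterlim_ident)
  then have "norm v \<le> K * 0"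
    by (rule tendsto_lowerbound)
      (auto intro!: eventually_mono[OF eventually_ge_at_top[of s0]] assms(2))
  then show ?thesis by simp
qed

lemma norm_vertical_integral_le:
  assumes "continuous_on UNIV (\<lambda>y. F (Complex c y))" "\<And>y. norm (F (Complex c y)) \<le> M / (1 + y\<^sup>2)"
  shows "norm (vertical_integral F c) \<le> M * (LINT y|lborel. 1 / (1 + y\<^sup>2))"
  unfolding vertical_integral_def by (rule norm_integral_quadratic_decay[OF assms])

lemma laplace_growth_le:
  assumes "\<bar>c\<bar> \<le> b"
  shows "laplace_growth rp rm c \<le> exp ((\<bar>rp\<bar> + \<bar>rm\<bar>) * b)"
proof -
  have "\<bar>rp * c\<bar> \<le> \<bar>rp\<bar> * b" "\<bar>rm * c\<bar> \<le> \<bar>rm\<bar> * b"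
    using assms by (auto simp: abs_mult intro!: mult_left_mono)
  moreover have "\<bar>rp\<bar> * b \<ge> 0" "\<bar>rm\<bar> * b \<ge> 0" using assms by auto
  ultimately show ?thesis by (auto simp: laplace_growth_def algebra_simps)
qed

text \<open>Supplies the strip hypothesis for shifts (z = 0) and for the residue formula: over a
  bounded range of c the weight and the exponential are bounded, and the decay of g in y
  remains.\<close>

lemma laplace_space_exp_strip_bound:
  assumes "g \<in> laplace_space"
  shows "\<exists>M. \<forall>c y. c1 \<le> c \<longrightarrow> c \<le> c2 \<longrightarrow>
    norm (g (Complex c y) * exp (of_real t * (Complex c y - z))) \<le> M / (1 + y\<^sup>2)"
proof -
  obtain rp C rm :: real where "rp < 0" and C: "C \<ge> 0" and "\<And>c y. norm (g (Complex c y)) \<le> C * laplace_growth rp rm c / (1 + y\<^sup>2)\<^sup>2"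
    and b: "\<And>c y. norm (g (Complex c y)) \<le> C * laplace_growth rp rm c / (1 + y\<^sup>2)"
    using laplace_space_bound_lines[OF assms] by metis
  define K where "K = max \<bar>c1\<bar> \<bar>c2\<bar>"
  define M where "M = C * exp ((\<bar>rp\<bar> + \<bar>rm\<bar>) * K) * exp (\<bar>t\<bar> * (K + \<bar>Re z\<bar>))"
  have "norm (g (Complex c y) * exp (of_real t * (Complex c y - z))) \<le> M / (1 + y\<^sup>2)"
    if "c1 \<le> c" "c \<le> c2" for c y
  proof -
    have cK: "\<bar>c\<bar> \<le> K" using that by (auto simp: K_def)
    have "C * laplace_growth rp rm c / (1 + y\<^sup>2) \<le> C * exp ((\<bar>rp\<bar> + \<bar>rm\<bar>) * K) / (1 + y\<^sup>2)"
      using laplace_growth_le[OF cK] C by (intro divide_right_mono mult_left_mono) auto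
    then have 1: "norm (g (Complex c y)) \<le> C * exp ((\<bar>rp\<bar> + \<bar>rm\<bar>) * K) / (1 + y\<^sup>2)"
      using b[of c y] by linarith
    have "t * (c - Re z) \<le> \<bar>t\<bar> * \<bar>c - Re z\<bar>" by (metis abs_ge_self abs_mult)
    also have "\<dots> \<le> \<bar>t\<bar> * (K + \<bar>Re z\<bar>)" using cK by (intro mult_left_mono) auto
    finally have 2: "norm (exp (of_real t * (Complex c y - z))) \<le> exp (\<bar>t\<bar> * (K + \<bar>Re z\<bar>))" by simp
    show ?thesis
      unfolding norm_mult M_def by (rule order_trans[OF mult_mono[OF 1 2]]) (use C in \<open>auto intro!: divide_nonneg_nonneg\<close>)
  qed
  then show ?thesis by blast
qed

lemma vertical_integral_laplace_space_shift:
  assumes "g \<in> laplace_space"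
  shows "vertical_integral (\<lambda>w. g w * exp (of_real t * w)) c = vertical_integral (\<lambda>w. g w * exp (of_real t * w)) c'"
proof -
  have "vertical_integral (\<lambda>w. g w * exp (of_real t * w)) c = vertical_integral (\<lambda>w. g w * exp (of_real t * w)) c'" if "c \<le> c'" for c c'
  proof -
    obtain M where M: "\<And>d y. c \<le> d \<Longrightarrow> d \<le> c' \<Longrightarrow>
        norm (g (Complex d y) * exp (of_real t * (Complex d y - 0))) \<le> M / (1 + y\<^sup>2)"
      using laplace_space_exp_strip_bound[OF assms, of c c' t 0] by metis
    show ?thesis
      by (rule vertical_integral_shift[OF _ that])
         (use M laplace_space_entire[OF assms] in \<open>auto intro!: holomorphic_intros\<close>)
  qed
  then show ?thesis by (metis linear)
qed

text \<open>
  The right-hand side \<open>J(b) - J(0)\<close> comes from the primitive \<open>J(t)\<close>, the line integral of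
  \<open>g(w) e\<^sup>t\<^sup>(\<^sup>w\<^sup>-\<^sup>z\<^sup>) / (w - z)\<close>; this avoids Fubini. The line \<open>Re w = Re z + 1\<close> may be any line to
  the right of \<open>z\<close>.
\<close>
lemma integral_inv_laplace:
  assumes "g \<in> laplace_space" and b: "b \<ge> 0"
  shows "integral {0..b} (\<lambda>t. exp (- (of_real t * z)) * inv_laplace g t) =
    (vertical_integral (\<lambda>w. g w * exp (of_real b * (w - z)) / (w - z)) (Re z + 1)
     - vertical_integral (\<lambda>w. g w / (w - z)) (Re z + 1)) / of_real (2 * pi)"
proof -
  let ?c = "Re z + 1"
  let ?J = "\<lambda>t. vertical_integral (\<lambda>w. g w / (w - z) * exp (of_real t * (w - z))) ?c"
  have nz: "Complex ?c y - z \<noteq> 0" for y by (auto simp: complex_eq_iff)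
  obtain rp C rm :: real where "rp < 0" "C \<ge> 0" and bd: "\<And>c y. norm (g (Complex c y)) \<le> C * laplace_growth rp rm c / (1 + y\<^sup>2)\<^sup>2"
    using laplace_space_bound_lines[OF assms(1)] by metis
  have J: "(?J has_vector_derivative exp (- (of_real t * z)) * (of_real (2 * pi) * inv_laplace g t)) (at t)" for t
  proof -
    have "(?J has_vector_derivative
        vertical_integral (\<lambda>w. (w - z) * (g w / (w - z)) * exp (of_real t * (w - z))) ?c) (at t)"
    proof (rule has_vector_derivative_vertical_integral_exp)
      show "continuous_on UNIV (\<lambda>y. g (Complex ?c y) / (Complex ?c y - z))"
        using nz by (intro continuous_intros continuous_on_laplace_space_line[OF assms(1)]) (auto simp: Complex_eq intro!: continuous_intros)
      fix y
      have "norm (Complex ?c y - z) \<ge> 1" using abs_Re_le_cmod[of "Complex ?c y - z"] by simp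
      then have "norm (g (Complex ?c y) / (Complex ?c y - z)) \<le> norm (g (Complex ?c y)) / 1"
        unfolding norm_divide by (intro divide_left_mono) auto
      then show "norm (g (Complex ?c y) / (Complex ?c y - z)) \<le> C * laplace_growth rp rm ?c / (1 + y\<^sup>2)\<^sup>2"
        using bd[of ?c y] by simp
    qed
    also have "vertical_integral (\<lambda>w. (w - z) * (g w / (w - z)) * exp (of_real t * (w - z))) ?c
        = vertical_integral (\<lambda>w. exp (- (of_real t * z)) * (g w * exp (of_real t * w))) ?c"
      unfolding vertical_integral_def
      by (intro Bochner_Integration.integral_cong refl)
         (use nz in \<open>simp add: algebra_simps exp_diff exp_minus field_simps\<close>)
    also have "\<dots> = exp (- (of_real t * z)) * vertical_integral (\<lambda>w. g w * exp (of_real t * w)) ?c"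
      unfolding vertical_integral_def by (rule integral_mult_right_zero)
    \<comment> \<open>With the denominator cancelled the integrand is entire, so the line may move
      from Re z + 1 to the imaginary axis.\<close>
    also have "vertical_integral (\<lambda>w. g w * exp (of_real t * w)) ?c = of_real (2 * pi) * inv_laplace g t"
      unfolding inv_laplace_def using vertical_integral_laplace_space_shift[OF assms(1), of t ?c 0] by simp
    finally show ?thesis .
  qed
  have "((\<lambda>t. exp (- (of_real t * z)) * (of_real (2 * pi) * inv_laplace g t)) has_integral ?J b - ?J 0) {0..b}"
    by (rule fundamental_theorem_of_calculus[OF b])
       (use J in \<open>auto intro: has_vector_derivative_at_within\<close>)
  then have "((\<lambda>t. exp (- (of_real t * z)) * (of_real (2 * pi) * inv_laplace g t) / of_real (2 * pi))
      has_integral (?J b - ?J 0) / of_real (2 * pi)) {0..b}"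
    by (rule has_integral_divide)
  then show ?thesis by (simp add: integral_unique)
qed

lemma laplace_inv_laplace:
  assumes "g \<in> laplace_space"
  obtains a b where "0 < a" "a \<le> b" "\<And>t. t \<notin> {a..b} \<Longrightarrow> inv_laplace g t = 0"
    and "\<And>z. integral {0..b} (\<lambda>t. exp (- (of_real t * z)) * inv_laplace g t) = g z"
proof -
  obtain rp C rm :: real where rp: "rp < 0" and C: "C \<ge> 0" and "\<And>c y. norm (g (Complex c y)) \<le> C * laplace_growth rp rm c / (1 + y\<^sup>2)\<^sup>2"
    and bd: "\<And>c y. norm (g (Complex c y)) \<le> C * laplace_growth rp rm c / (1 + y\<^sup>2)"
    using laplace_space_bound_lines[OF assms] by metis
  \<comment> \<open>The estimates confine the support to [- rp, rm]. The excess 1 makes b > rm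
    strict, so that the term with exp (b (w - z)) decays to the left; the maximum secures a \<le>
    b.\<close>
  define a b where "a = - rp" and "b = max a rm + 1"
  define Q where "Q = (LINT y|lborel. 1 / (1 + y\<^sup>2) :: real)"
  have est: "norm (vertical_integral (\<lambda>w. g w * exp (of_real t * w)) c) \<le> C * laplace_growth rp rm c * exp (t * c) * Q"
    for t c
    unfolding Q_def
  proof (rule norm_vertical_integral_le)
    show "continuous_on UNIV (\<lambda>y. g (Complex c y) * exp (of_real t * Complex c y))"
      by (intro continuous_intros continuous_on_laplace_space_line[OF assms])
    fix y
    show "norm (g (Complex c y) * exp (of_real t * Complex c y)) \<le> C * laplace_growth rp rm c * exp (t * c) / (1 + y\<^sup>2)"
      using mult_right_mono[OF bd[of c y], of "exp (t * c)"] by (simp add: norm_mult)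
  qed
  have v0: "inv_laplace g t = 0" if t: "t \<notin> {a..b}" for t
  proof -
    let ?v = "vertical_integral (\<lambda>w. g w * exp (of_real t * w)) 0"
    have v: "norm ?v \<le> C * laplace_growth rp rm c * exp (t * c) * Q" for c
      using est[of t c] vertical_integral_laplace_space_shift[OF assms, of t 0 c] by simp
    consider "t < a" | "t > b" using t by force
    then have "?v = 0"
    proof cases
      case 1
      show ?thesis
      proof (rule eq_0_if_norm_le_exp_decay[of "a - t" 0 _ "C * Q"])
        fix s :: real assume "s \<ge> 0"
        then show "norm ?v \<le> C * Q * exp (- ((a - t) * s))"
          using v[of s] by (simp add: laplace_growth_def a_def algebra_simps exp_add[symmetric])
      qed (use 1 in auto)
    next
      case 2
      \<comment> \<open>Starting at s = 1 keeps the line Re w = - s strictly left of 0, on the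
        \<open>rm\<close> branch of the weight.\<close>
      show ?thesis
      proof (rule eq_0_if_norm_le_exp_decay[of "t - rm" 1 _ "C * Q"])
        fix s :: real assume "s \<ge> 1"
        then show "norm ?v \<le> C * Q * exp (- ((t - rm) * s))"
          using v[of "- s"] by (simp add: laplace_growth_def algebra_simps exp_add[symmetric])
      qed (use 2 in \<open>auto simp: b_def\<close>)
    qed
    then show ?thesis by (simp add: inv_laplace_def)
  qed
  have inv: "integral {0..b} (\<lambda>t. exp (- (of_real t * z)) * inv_laplace g t) = g z" for z
  proof -
    let ?V = "\<lambda>\<beta>. vertical_integral (\<lambda>w. g w * exp (of_real \<beta> * (w - z)) / (w - z))"
    have est: "norm (?V \<beta> c) \<le> C * laplace_growth rp rm c * exp (\<beta> * (c - Re z)) * Q"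
      if "\<bar>c - Re z\<bar> \<ge> 1" for \<beta> c
      unfolding Q_def
    proof (rule norm_vertical_integral_le)
      have nz: "Complex c y \<noteq> z" for y using that by auto
      show "continuous_on UNIV (\<lambda>y. g (Complex c y) * exp (of_real \<beta> * (Complex c y - z)) / (Complex c y - z))"
        using nz by (intro continuous_intros continuous_on_laplace_space_line[OF assms])
          (auto simp: Complex_eq intro!: continuous_intros)
      fix y
      let ?n = "norm (g (Complex c y)) * exp (\<beta> * (c - Re z))"
      have "norm (Complex c y - z) \<ge> 1" using abs_Re_le_cmod[of "Complex c y - z"] that by simp
      then have "?n / norm (Complex c y - z) \<le> ?n / 1"
        by (intro divide_left_mono) auto
      also have "\<dots> \<le> C * laplace_growth rp rm c / (1 + y\<^sup>2) * exp (\<beta> * (c - Re z))"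
        using mult_right_mono[OF bd[of c y], of "exp (\<beta> * (c - Re z))"] by simp
      finally show "norm (g (Complex c y) * exp (of_real \<beta> * (Complex c y - z)) / (Complex c y - z))
          \<le> C * laplace_growth rp rm c * exp (\<beta> * (c - Re z)) / (1 + y\<^sup>2)"
        by (simp add: norm_mult norm_divide)
    qed
    have res: "?V \<beta> c2 - ?V \<beta> c1 = of_real (2 * pi) * g z" if "c1 < Re z" "Re z < c2" for \<beta> c1 c2
    proof -
      obtain M where M: "\<And>c y. c1 \<le> c \<Longrightarrow> c \<le> c2 \<Longrightarrow>
          norm (g (Complex c y) * exp (of_real \<beta> * (Complex c y - z))) \<le> M / (1 + y\<^sup>2)"
        using laplace_space_exp_strip_bound[OF assms, of c1 c2 \<beta> z] by metis
      have "(\<lambda>w. g w * exp (of_real \<beta> * (w - z))) holomorphic_on UNIV"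
        using laplace_space_entire[OF assms] by (intro holomorphic_intros)
      from vertical_integral_residue[OF this that M] show ?thesis by simp
    qed
    \<comment> \<open>Two residue identities with the common left line Re z - 1 differ by a shift
      from Re z + 1 to s that does not cross z; the decay exp (- a s) of g then acts alone. The
      threshold \<bar>Re z\<bar> + 1 keeps the line at distance at least 1 from z, as
      \<open>est\<close> requires.\<close>
    have "?V 0 (Re z + 1) = 0"
    proof (rule eq_0_if_norm_le_exp_decay[of a "\<bar>Re z\<bar> + 1" _ "C * Q"])
      fix s assume s: "s \<ge> \<bar>Re z\<bar> + 1"
      have s1: "s \<ge> 0" "\<bar>s - Re z\<bar> \<ge> 1" using s by linarith+
      have "?V 0 (Re z + 1) = ?V 0 s"
        using res[of "Re z - 1" "Re z + 1" 0] res[of "Re z - 1" s 0] s by (simp add: algebra_simps)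
      then show "norm (?V 0 (Re z + 1)) \<le> C * Q * exp (- (a * s))"
        using est[of s 0] s1 by (simp add: laplace_growth_def a_def mult_ac)
    qed (use rp in \<open>simp add: a_def\<close>)
    \<comment> \<open>Moving left, the line crosses z and leaves the residue; the rest,
      \<open>?V b (- s)\<close>, decays because b > rm.\<close>
    moreover have "?V b (Re z + 1) - of_real (2 * pi) * g z = 0"
    proof (rule eq_0_if_norm_le_exp_decay[of "b - rm" "\<bar>Re z\<bar> + 1" _ "C * Q * exp (- (b * Re z))"])
      fix s assume s: "s \<ge> \<bar>Re z\<bar> + 1"
      have s1: "s > 0" "\<bar>- s - Re z\<bar> \<ge> 1" using s by linarith+
      have "?V b (Re z + 1) - of_real (2 * pi) * g z = ?V b (- s)"
        using res[of "- s" "Re z + 1" b] s by (simp add: algebra_simps)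
      then show "norm (?V b (Re z + 1) - of_real (2 * pi) * g z) \<le> C * Q * exp (- (b * Re z)) * exp (- ((b - rm) * s))"
        using est[OF s1(2), of b] s1(1) by (simp add: laplace_growth_def algebra_simps exp_add[symmetric])
    qed (simp add: b_def)
    ultimately show ?thesis
      using integral_inv_laplace[OF assms, of b z] rp by (simp add: b_def a_def)
  qed
  show ?thesis
    by (rule that[of a b]) (use v0 inv rp in \<open>auto simp: a_def b_def\<close>)
qed

subsection \<open>The Laplace transform of a test function\<close>

lemma integral_supported:
  fixes g :: "'a::euclidean_space \<Rightarrow> 'b::banach"
  assumes "\<And>t. t \<notin> S \<Longrightarrow> g t = 0" "S \<subseteq> T"
  shows "integral T g = integral S g"
proof -
  have "(\<lambda>x. if x \<in> S then g x else 0) = g" "(\<lambda>x. if x \<in> T then g x else 0) = g"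
    using assms by (auto simp: fun_eq_iff)
  then show ?thesis
    using integral_restrict_UNIV[of S g] integral_restrict_UNIV[of T g] by simp
qed

text \<open>The freedom in c and d lets each computation choose its interval; c may even be
  negative, as after a translation.\<close>

lemma laplace_eq_integral:
  assumes "continuous_on UNIV f" "\<And>t. t \<notin> {a..b} \<Longrightarrow> f t = 0" "0 < a" "c \<le> a" "b \<le> d"
  shows "laplace f z = integral {c..d} (\<lambda>t. exp (- (of_real t * z)) * f t)"
proof -
  let ?g = "\<lambda>t. exp (- (of_real t * z)) * f t"
  have g: "continuous_on {a..b} ?g"
    by (intro continuous_intros continuous_on_subset[OF assms(1)]) auto
  have "laplace f z = (LINT t:{a..b}|lborel. ?g t)"
    unfolding laplace_def set_lebesgue_integral_def
    by (intro Bochner_Integration.integral_cong refl) (use assms in \<open>auto simp: indicator_def\<close>)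
  also have "\<dots> = integral {a..b} ?g"
    by (rule set_borel_integral_eq_integral(2)[OF borel_integrable_atLeastAtMost'[OF g]])
  also have "\<dots> = integral {c..d} ?g"
    by (rule integral_supported[symmetric]) (use assms in auto)
  finally show ?thesis .
qed

lemma smooth_has_vector_derivative:
  "smooth f \<Longrightarrow> (nth_deriv n f has_vector_derivative nth_deriv (Suc n) f t) (at t)"
  by (simp add: smooth_def nth_deriv_Suc vector_derivative_works)

lemma smooth_continuous_nth_deriv: "smooth f \<Longrightarrow> continuous_on S (nth_deriv n f)"
  by (intro differentiable_imp_continuous_on)
     (auto simp: smooth_def differentiable_on_def intro: differentiable_at_withinI)

lemma smooth_continuous: "smooth f \<Longrightarrow> continuous_on S f"
  using smooth_continuous_nth_deriv[of f S 0] by simp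

lemma nth_deriv_add: "nth_deriv m (nth_deriv n f) = nth_deriv (m + n) f"
  by (simp add: nth_deriv_def funpow_add)

lemma nth_deriv_test_functions_on:
  assumes "f \<in> test_functions_on {a..b}"
  shows "nth_deriv n f \<in> test_functions_on {a..b}"
proof -
  have s: "smooth f" using assms by (simp add: test_functions_on_def)
  have "nth_deriv n f t = 0" if "t \<notin> {a..b}" for t
    using that
  proof (induction n arbitrary: t)
    case 0
    then show ?case using assms by (simp add: test_functions_on_def)
  next
    case (Suc n)
    have "(nth_deriv n f has_vector_derivative 0) (at t)"
      by (rule has_vector_derivative_transform_within_open[where S="- {a..b}" and f="\<lambda>_. 0"])
         (use Suc in auto)
    then show ?case unfolding nth_deriv_Suc by (rule vector_derivative_at)
  qed
  moreover have "smooth (nth_deriv n f)"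
    using s unfolding smooth_def nth_deriv_add by blast
  ultimately show ?thesis by (simp add: test_functions_on_def)
qed

lemma test_functionsE:
  assumes "f \<in> test_functions"
  obtains a b where "0 < a" "a \<le> b" "f \<in> test_functions_on {a..b}"
proof -
  obtain K where K: "compact K" "K \<subseteq> {0<..}" and f: "f \<in> test_functions_on K"
    using assms by (auto simp: test_functions_def)
  show ?thesis
  proof (cases "K = {}")
    case True
    \<comment> \<open>Here f vanishes identically, so any interval in the half-line serves.\<close>
    then show ?thesis using f that[of 1 1] by (auto simp: test_functions_on_def)
  next
    case False
    obtain a where a: "a \<in> K" "\<And>t. t \<in> K \<Longrightarrow> a \<le> t" using compact_attains_inf[OF K(1) False] by blast
    obtain b where b: "b \<in> K" "\<And>t. t \<in> K \<Longrightarrow> t \<le> b" using compact_attains_sup[OF K(1) False] by blast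
    have "f t = 0" if "t \<notin> {a..b}" for t
      using f that a(2)[of t] b(2)[of t] by (auto simp: test_functions_on_def)
    then have "f \<in> test_functions_on {a..b}" using f by (simp add: test_functions_on_def)
    moreover have "0 < a" "a \<le> b" using a b K by auto
    ultimately show ?thesis using that by blast
  qed
qed

lemma test_functionsI:
  assumes "0 < a" "f \<in> test_functions_on {a..b}"
  shows "f \<in> test_functions"
  unfolding test_functions_def by (rule UN_I[of "{a..b}"]) (use assms in auto)

lemma laplace_test_function_eq_integral:
  assumes "f \<in> test_functions_on {a..b}" "0 < a" "c \<le> a" "b \<le> d"
  shows "laplace f z = integral {c..d} (\<lambda>t. exp (- (of_real t * z)) * f t)"
  by (rule laplace_eq_integral) (use assms in \<open>auto simp: test_functions_on_def smooth_continuous\<close>)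

lemma laplace_nth_deriv_1:
  assumes f: "f \<in> test_functions_on {a..b}" and a: "0 < a" "a \<le> b"
  shows "laplace (nth_deriv 1 f) z = z * laplace f z"
proof -
  have s: "smooth f" and f0: "\<And>t. t \<notin> {a..b} \<Longrightarrow> f t = 0" using f by (auto simp: test_functions_on_def)
  let ?e = "\<lambda>t. exp (- (of_real t * z))"
  let ?f' = "nth_deriv 1 f"
  have e: "(?e has_vector_derivative - z * ?e t) (at t)" for t
    by (rule has_vector_derivative_eq_rhs, rule has_vector_derivative_real_field)
       (auto intro!: derivative_eq_intros)
  have f': "(f has_vector_derivative ?f' t) (at t)" for t
    using smooth_has_vector_derivative[OF s, of 0 t] by simp
  \<comment> \<open>Integration by parts. The endpoints 0 and b + 1 lie outside [a, b], so the
    boundary terms vanish by the support condition alone.\<close>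
  have "((\<lambda>t. ?e t * ?f' t + - z * ?e t * f t) has_integral ?e (b + 1) * f (b + 1) - ?e 0 * f 0) {0..b + 1}"
    by (rule fundamental_theorem_of_calculus[where f="\<lambda>t. ?e t * f t",
          OF _ has_vector_derivative_at_within[OF has_vector_derivative_mult[OF e f']]]) (use a in simp)
  then have 1: "integral {0..b + 1} (\<lambda>t. ?e t * ?f' t + - z * (?e t * f t)) = 0"
    using f0[of 0] f0[of "b + 1"] a by (simp add: integral_unique mult.assoc)
  have i: "(\<lambda>t. ?e t * ?f' t) integrable_on {0..b + 1}" "(\<lambda>t. ?e t * f t) integrable_on {0..b + 1}"
    by (intro integrable_continuous_real continuous_intros smooth_continuous_nth_deriv[OF s]
          smooth_continuous[OF s])+
  have "integral {0..b + 1} (\<lambda>t. ?e t * ?f' t) - z * integral {0..b + 1} (\<lambda>t. ?e t * f t) = 0"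
    using 1 integral_add[OF i(1) integrable_on_mult_right[OF i(2), of "- z"]] by simp
  moreover have "integral {0..b + 1} (\<lambda>t. ?e t * f t) = laplace f z"
    "integral {0..b + 1} (\<lambda>t. ?e t * ?f' t) = laplace ?f' z"
    using a by (auto intro!: laplace_test_function_eq_integral[symmetric] f nth_deriv_test_functions_on)
  ultimately show ?thesis by simp
qed

lemma laplace_nth_deriv:
  assumes f: "f \<in> test_functions_on {a..b}" and a: "0 < a" "a \<le> b"
  shows "laplace (nth_deriv n f) z = z ^ n * laplace f z"
proof (induction n)
  case (Suc n)
  have "nth_deriv (Suc n) f = nth_deriv 1 (nth_deriv n f)" by (simp add: nth_deriv_add)
  then show ?case
    using laplace_nth_deriv_1[OF nth_deriv_test_functions_on[OF f] a] Suc by simp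
qed simp

text \<open>On [a, b], exp (- t Re z) is largest at t = a for Re z \<ge> 0 and at t = b for Re z
  \<le> 0; the ends of the support become the exponential rates.\<close>

lemma laplace_growth_bound:
  assumes f: "f \<in> test_functions_on {a..b}" and a: "0 < a" "a \<le> b"
  shows "\<exists>M\<ge>0. \<forall>z. norm (laplace f z) \<le> M * laplace_growth (- a) b (Re z)"
proof -
  have s: "smooth f" using f by (auto simp: test_functions_on_def)
  have "compact (f ` {a..b})" by (intro compact_continuous_image smooth_continuous[OF s]) auto
  then obtain B where B: "\<And>t. t \<in> {a..b} \<Longrightarrow> norm (f t) \<le> B"
    using compact_imp_bounded bounded_iff by (metis imageI)
  have B0: "B \<ge> 0" using order_trans[OF norm_ge_zero B[of a]] a by simp
  have "norm (laplace f z) \<le> B * (b - a) * laplace_growth (- a) b (Re z)" for z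
  proof -
    have "norm (laplace f z) = norm (integral {a..b} (\<lambda>t. exp (- (of_real t * z)) * f t))"
      using laplace_test_function_eq_integral[OF f a(1) order_refl order_refl] by simp
    also have "\<dots> \<le> laplace_growth (- a) b (Re z) * B * (b - a)"
    proof (rule integral_bound[OF a(2)])
      show "continuous_on {a..b} (\<lambda>t. exp (- (of_real t * z)) * f t)"
        by (intro continuous_intros smooth_continuous[OF s])
      fix t assume t: "t \<in> {a..b}"
      have "exp (- (t * Re z)) \<le> laplace_growth (- a) b (Re z)"
        using t by (auto simp: laplace_growth_def mult_right_mono mult_right_mono_neg)
      then show "norm (exp (- (of_real t * z)) * f t) \<le> laplace_growth (- a) b (Re z) * B"
        unfolding norm_mult using B[OF t] by (intro mult_mono) (auto simp: laplace_growth_def)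
    qed
    finally show ?thesis by (simp add: mult_ac)
  qed
  then show ?thesis using B0 a by (intro exI[of _ "B * (b - a)"]) auto
qed

lemma laplace_holomorphic:
  assumes f: "f \<in> test_functions_on {a..b}" and a: "0 < a" "a \<le> b"
  shows "laplace f holomorphic_on UNIV"
proof -
  have s: "smooth f" using f by (auto simp: test_functions_on_def)
  have "(\<lambda>z. integral (cbox a b) (\<lambda>t. exp (- (of_real t * z)) * f t)) holomorphic_on UNIV"
  proof (rule leibniz_rule_holomorphic)
    fix z :: complex and t
    show "((\<lambda>z. exp (- (of_real t * z)) * f t) has_field_derivative - of_real t * exp (- (of_real t * z)) * f t)
      (at z within UNIV)"
      by (auto intro!: derivative_eq_intros)
  next
    show "(\<lambda>t. exp (- (of_real t * z)) * f t) integrable_on cbox a b" for z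
      by (intro integrable_continuous continuous_intros smooth_continuous[OF s])
  next
    have "continuous_on (UNIV \<times> cbox a b) (\<lambda>x. f (snd x))"
      by (rule continuous_on_compose2[OF smooth_continuous[OF s, of UNIV]]) (auto intro: continuous_intros)
    then show "continuous_on (UNIV \<times> cbox a b) (\<lambda>(z, t). - of_real t * exp (- (of_real t * z)) * f t)"
      unfolding split_beta by (intro continuous_intros)
  qed simp
  moreover have "laplace f = (\<lambda>z. integral (cbox a b) (\<lambda>t. exp (- (of_real t * z)) * f t))"
    using laplace_test_function_eq_integral[OF f a(1) order_refl order_refl] by auto
  ultimately show ?thesis by simp
qed

text \<open>Decay is bought with derivatives: z^n L f is the transform of the n-th derivative, which
  obeys the same exponential bound, and (1 + |z|)^n \<le> 2^n (1 + |z|^n).\<close>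

lemma laplace_in_laplace_space:
  assumes "f \<in> test_functions"
  shows "laplace f \<in> laplace_space"
proof -
  obtain a b where a: "0 < a" "a \<le> b" and f: "f \<in> test_functions_on {a..b}"
    using test_functionsE[OF assms] .
  have "\<exists>C. \<forall>z. norm (laplace f z) \<le> C / (1 + norm z) ^ n * laplace_growth (- a) b (Re z)" for n
  proof -
    obtain M where M: "M \<ge> 0" "\<And>z. norm (laplace f z) \<le> M * laplace_growth (- a) b (Re z)"
      using laplace_growth_bound[OF f a] by metis
    obtain N where N: "N \<ge> 0" "\<And>z. norm (laplace (nth_deriv n f) z) \<le> N * laplace_growth (- a) b (Re z)"
      using laplace_growth_bound[OF nth_deriv_test_functions_on[OF f] a] by metis
    have "norm (laplace f z) \<le> 2 ^ n * (M + N) / (1 + norm z) ^ n * laplace_growth (- a) b (Re z)" for z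
    proof -
      have "(1 + norm z) ^ n \<le> (2 * max 1 (norm z)) ^ n" by (intro power_mono) auto
      also have "\<dots> \<le> 2 ^ n * (1 + norm z ^ n)"
        unfolding power_mult_distrib by (intro mult_left_mono) (auto simp: max_def)
      finally have "norm (laplace f z) * (1 + norm z) ^ n \<le> norm (laplace f z) * (2 ^ n * (1 + norm z ^ n))"
        by (intro mult_left_mono) auto
      also have "\<dots> = 2 ^ n * (norm (laplace f z) + norm (laplace (nth_deriv n f) z))"
        by (simp add: laplace_nth_deriv[OF f a] norm_mult norm_power algebra_simps)
      also have "\<dots> \<le> 2 ^ n * (M * laplace_growth (- a) b (Re z) + N * laplace_growth (- a) b (Re z))"
        by (intro mult_left_mono add_mono M N) auto
      finally have le: "norm (laplace f z) * (1 + norm z) ^ n \<le> 2 ^ n * (M + N) * laplace_growth (- a) b (Re z)"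
        by (simp add: algebra_simps)
      have "(1 + norm z) ^ n > 0" by (intro zero_less_power add_pos_nonneg) auto
      then show ?thesis using le by (simp add: pos_le_divide_eq)
    qed
    then show ?thesis by blast
  qed
  then obtain C where C: "\<And>n z. norm (laplace f z) \<le> C n / (1 + norm z) ^ n * laplace_growth (- a) b (Re z)"
    by metis
  show ?thesis
    unfolding laplace_space_def
  proof (intro CollectI conjI exI allI)
    show "laplace f holomorphic_on UNIV" by (rule laplace_holomorphic[OF f a])
    show "- a < 0" using a by simp
    fix n :: nat and z :: complex
    show "0 \<le> Re z \<longrightarrow> norm (laplace f z) \<le> C n / (1 + norm z) ^ n * exp (- a * \<bar>Re z\<bar>)"
      "Re z \<le> 0 \<longrightarrow> norm (laplace f z) \<le> C n / (1 + norm z) ^ n * exp (b * \<bar>Re z\<bar>)"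
      using C[of z n] by (auto simp: laplace_growth_def split: if_splits)
  qed
qed

section \<open>Injectivity of the Laplace transform\<close>

text \<open>\<phi> is orthogonal to every polynomial in exp (- t). If such a polynomial p is within
  e of \<phi>, the integral of \<phi>^2 equals that of \<phi> (\<phi> - p), hence is at most e N; so
  it is 0.\<close>

lemma exponential_moments_zero_imp_zero:
  fixes \<phi> :: "real \<Rightarrow> real"
  assumes ab: "a < b" and cont: "continuous_on {a..b} \<phi>"
    and mom: "\<And>n::nat. integral {a..b} (\<lambda>t. exp (- t) ^ n * \<phi> t) = 0" and t: "t \<in> {a..b}"
  shows "\<phi> t = 0"
proof -
  let ?S = "{exp (- b)..exp (- a)}"
  have Spos: "x > 0" if "x \<in> ?S" for x using that exp_gt_zero[of "- b"] by (simp del: exp_gt_zero)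
  have psi: "continuous_on ?S (\<lambda>x. \<phi> (- ln x))"
  proof (rule continuous_on_compose2[OF cont])
    show "continuous_on ?S (\<lambda>x. - ln x)" using Spos by (intro continuous_intros) force
    show "(\<lambda>x. - ln x) ` ?S \<subseteq> {a..b}"
    proof (rule image_subsetI)
      fix x assume x: "x \<in> ?S"
      then show "- ln x \<in> {a..b}"
        using Spos[OF x] ln_le_cancel_iff[of "exp (- b)" x] ln_le_cancel_iff[of x "exp (- a)"] by simp
    qed
  qed
  have c: "continuous_on {a..b} (\<lambda>t. \<bar>\<phi> t\<bar>)" "continuous_on {a..b} (\<lambda>t. (\<phi> t)\<^sup>2)"
    using cont by (auto intro: continuous_intros)
  define N where "N = integral {a..b} (\<lambda>t. \<bar>\<phi> t\<bar>)"
  have N0: "N \<ge> 0" unfolding N_def by (intro Henstock_Kurzweil_Integration.integral_nonneg integrable_continuous_real c) auto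
  have small: "integral {a..b} (\<lambda>t. (\<phi> t)\<^sup>2) \<le> e * N" if e: "e > 0" for e
  proof -
    obtain p where p: "real_polynomial_function p" "\<And>x. x \<in> ?S \<Longrightarrow> \<bar>\<phi> (- ln x) - p x\<bar> < e"
      using Stone_Weierstrass_real_polynomial_function[OF compact_Icc psi e] by metis
    obtain A m where A: "p = (\<lambda>x. \<Sum>i\<le>m. A i * x ^ i)" using p(1) real_polynomial_function_iff_sum by blast
    have q: "continuous_on {a..b} (\<lambda>t. \<phi> t * p (exp (- t)))"
      unfolding A by (intro continuous_intros cont)
    have "integral {a..b} (\<lambda>t. \<phi> t * p (exp (- t))) = integral {a..b} (\<lambda>t. \<Sum>i\<le>m. A i * (exp (- t) ^ i * \<phi> t))"
      by (intro integral_cong) (simp add: A sum_distrib_left mult_ac)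
    also have "\<dots> = (\<Sum>i\<le>m. integral {a..b} (\<lambda>t. A i * (exp (- t) ^ i * \<phi> t)))"
      by (intro integral_sum integrable_continuous_real continuous_intros cont) auto
    also have "\<dots> = 0" by (simp add: mom del: exp_minus)
    finally have z: "integral {a..b} (\<lambda>t. \<phi> t * p (exp (- t))) = 0" .
    have "integral {a..b} (\<lambda>t. (\<phi> t)\<^sup>2) = integral {a..b} (\<lambda>t. (\<phi> t)\<^sup>2 - \<phi> t * p (exp (- t)))"
      using z Henstock_Kurzweil_Integration.integral_diff[OF integrable_continuous_real[OF c(2)] integrable_continuous_real[OF q]] by simp
    also have "\<dots> \<le> integral {a..b} (\<lambda>t. e * \<bar>\<phi> t\<bar>)"
    proof (rule integral_le)
      fix t assume t: "t \<in> {a..b}"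
      then have "\<bar>\<phi> t - p (exp (- t))\<bar> < e" using p(2)[of "exp (- t)"] by auto
      then have "\<bar>\<phi> t\<bar> * \<bar>\<phi> t - p (exp (- t))\<bar> \<le> \<bar>\<phi> t\<bar> * e" by (intro mult_left_mono) auto
      moreover have "(\<phi> t)\<^sup>2 - \<phi> t * p (exp (- t)) = \<phi> t * (\<phi> t - p (exp (- t)))"
        by (simp add: power2_eq_square algebra_simps)
      ultimately show "(\<phi> t)\<^sup>2 - \<phi> t * p (exp (- t)) \<le> e * \<bar>\<phi> t\<bar>"
        using abs_ge_self[of "\<phi> t * (\<phi> t - p (exp (- t)))"] by (simp only: abs_mult mult.commute[of e])
    qed (intro integrable_continuous_real continuous_intros c q)+
    also have "\<dots> = e * N" by (simp add: N_def)
    finally show ?thesis .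
  qed
  have "integral {a..b} (\<lambda>t. (\<phi> t)\<^sup>2) \<le> 0"
  proof (rule field_le_epsilon)
    fix e :: real assume e: "e > 0"
    \<comment> \<open>N may be 0, so the tolerance is e / (N + 1).\<close>
    have "integral {a..b} (\<lambda>t. (\<phi> t)\<^sup>2) \<le> e / (N + 1) * N" using N0 e by (intro small) auto
    also have "\<dots> \<le> e" using N0 e by (simp add: field_simps)
    finally show "integral {a..b} (\<lambda>t. (\<phi> t)\<^sup>2) \<le> 0 + e" by simp
  qed
  moreover have "integral {a..b} (\<lambda>t. (\<phi> t)\<^sup>2) \<ge> 0"
    by (intro Henstock_Kurzweil_Integration.integral_nonneg integrable_continuous_real c) auto
  ultimately have "integral {a..b} (\<lambda>t. (\<phi> t)\<^sup>2) = 0" by simp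
  then show ?thesis using integral_eq_0_iff[OF c(2) ab] t by auto
qed

text \<open>At z = n the kernel is the n-th power of exp (- t), so the natural numbers provide all
  moments; being real there, it lets real and imaginary parts be treated separately.\<close>

lemma laplace_eq_0_imp_eq_0:
  assumes f: "f \<in> test_functions_on {a..b}" and a: "0 < a" "a \<le> b" and L: "\<And>n::nat. laplace f (of_nat n) = 0"
  shows "f = (\<lambda>_. 0)"
proof
  fix t
  have s: "smooth f" and f0: "\<And>t. t \<notin> {a..b} \<Longrightarrow> f t = 0" using f by (auto simp: test_functions_on_def)
  let ?h = "\<lambda>n t. exp (- (of_real t * of_nat n)) * f t"
  \<comment> \<open>The support may degenerate to a = b, while the moment argument needs a proper
    interval; hence b + 1.\<close>
  have i: "?h n integrable_on {a..b + 1}" for n :: nat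
    by (intro integrable_continuous_real continuous_intros smooth_continuous[OF s])
  have h: "integral {a..b + 1} (?h n) = 0" for n :: nat
    using laplace_test_function_eq_integral[OF f a(1), of a "b + 1" "of_nat n"] L[of n] by simp
  have e: "exp (- (of_real t * of_nat n)) = (of_real (exp (- t) ^ n) :: complex)" for t and n :: nat
    by (simp add: exp_of_nat_mult[symmetric] exp_of_real[symmetric] mult.commute del: exp_of_real)
  have ReIm: "Re \<circ> ?h n = (\<lambda>t. exp (- t) ^ n * Re (f t))" "Im \<circ> ?h n = (\<lambda>t. exp (- t) ^ n * Im (f t))"
    for n :: nat
    unfolding e by (auto simp: fun_eq_iff simp del: of_real_power)
  have "integral {a..b + 1} (\<lambda>t. exp (- t) ^ n * Re (f t)) = 0"
    "integral {a..b + 1} (\<lambda>t. exp (- t) ^ n * Im (f t)) = 0" for n :: nat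
    using integral_linear[OF i bounded_linear_Re, of n] integral_linear[OF i bounded_linear_Im, of n]
    unfolding ReIm h by simp_all
  moreover have "a < b + 1" "continuous_on {a..b + 1} (\<lambda>t. Re (f t))" "continuous_on {a..b + 1} (\<lambda>t. Im (f t))"
    using a by (auto intro: continuous_intros smooth_continuous[OF s])
  ultimately have "Re (f t) = 0 \<and> Im (f t) = 0" if "t \<in> {a..b + 1}"
    using exponential_moments_zero_imp_zero[of a "b + 1" "\<lambda>t. Re (f t)" t]
      exponential_moments_zero_imp_zero[of a "b + 1" "\<lambda>t. Im (f t)" t] that by blast
  then show "f t = 0" using f0[of t] by (cases "t \<in> {a..b}") (auto simp: complex_eq_iff)
qed

subsection \<open>Convolution\<close>

lemma laplace_conv_eq_integral:
  assumes "continuous_on UNIV u" "\<And>t. t \<notin> {a..b} \<Longrightarrow> u t = 0" "0 < a" "continuous_on UNIV v"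
  shows "laplace_conv u v t = integral {a..b} (\<lambda>s. u s * v (t - s))"
proof -
  have "continuous_on UNIV (\<lambda>s. v (t - s))"
    by (rule continuous_on_compose2[OF assms(4)]) (auto intro: continuous_intros)
  then have "continuous_on UNIV (\<lambda>s. u s * v (t - s))" by (intro continuous_on_mult assms(1))
  \<comment> \<open>At z = 0 the kernel is 1: the convolution is a Laplace transform in s, and its
    restriction to [a, b] is inherited.\<close>
  from laplace_eq_integral[OF this, of a b a b 0] show ?thesis
    using assms(2,3) by (simp add: laplace_conv_def laplace_def)
qed

text \<open>Differentiation in t meets v only, so continuity of u on its compact support suffices,
  also when the step is iterated.\<close>

lemma laplace_conv_has_vector_derivative:
  assumes u: "continuous_on UNIV u" "\<And>t. t \<notin> {a..b} \<Longrightarrow> u t = 0" "0 < a" and v: "smooth v"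
  shows "(laplace_conv u v has_vector_derivative laplace_conv u (nth_deriv 1 v) t) (at t)"
proof -
  have c: "continuous_on UNIV (\<lambda>p::real \<times> real. v' (fst p - snd p))" if "continuous_on UNIV v'" for v' :: "real \<Rightarrow> complex"
    by (rule continuous_on_compose2[OF that]) (auto intro!: continuous_intros)
  have "((\<lambda>t. integral (cbox a b) (\<lambda>s. u s * v (t - s))) has_vector_derivative
      integral (cbox a b) (\<lambda>s. u s * nth_deriv 1 v (t - s))) (at t within UNIV)"
  proof (rule leibniz_rule_vector_derivative)
    fix t s
    have "((\<lambda>t. v (t - s)) has_vector_derivative 1 *\<^sub>R nth_deriv 1 v (t - s)) (at t)"
      by (rule vector_diff_chain_at[of "\<lambda>t. t - s" 1 t v, unfolded o_def])
         (use smooth_has_vector_derivative[OF v, of 0] in \<open>auto intro!: derivative_eq_intros\<close>)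
    then show "((\<lambda>t. u s * v (t - s)) has_vector_derivative u s * nth_deriv 1 v (t - s)) (at t within UNIV)"
      by (intro has_vector_derivative_mult_right) simp
  next
    fix t
    have "continuous_on (cbox a b) (\<lambda>s. v (t - s))"
      by (rule continuous_on_compose2[OF smooth_continuous[OF v, of UNIV]]) (auto intro: continuous_intros)
    then show "(\<lambda>s. u s * v (t - s)) integrable_on cbox a b"
      by (intro integrable_continuous continuous_on_mult continuous_on_subset[OF u(1)]) auto
  next
    have "continuous_on (UNIV \<times> cbox a b) (\<lambda>p. u (snd p))"
      by (rule continuous_on_compose2[OF u(1)]) (auto intro: continuous_intros)
    then show "continuous_on (UNIV \<times> cbox a b) (\<lambda>(t, s). u s * nth_deriv 1 v (t - s))"
      unfolding split_beta
      by (intro continuous_on_mult continuous_on_subset[OF c[OF smooth_continuous_nth_deriv[OF v, of UNIV 1]]]) auto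
  qed auto
  moreover have "laplace_conv u v = (\<lambda>t. integral (cbox a b) (\<lambda>s. u s * v (t - s)))"
    using laplace_conv_eq_integral[OF u smooth_continuous[OF v]] by auto
  ultimately show ?thesis
    using laplace_conv_eq_integral[OF u smooth_continuous_nth_deriv[OF v, of _ 1]] by simp
qed

lemma laplace_conv_in_test_functions_on:
  assumes u: "continuous_on UNIV u" "\<And>t. t \<notin> {a..b} \<Longrightarrow> u t = 0" "0 < a"
    and v: "v \<in> test_functions_on {c..d}"
  shows "laplace_conv u v \<in> test_functions_on {a + c..b + d}"
proof -
  have s: "smooth (nth_deriv n v)" for n
    using nth_deriv_test_functions_on[OF v] by (simp add: test_functions_on_def)
  have D: "(laplace_conv u (nth_deriv n v) has_vector_derivative laplace_conv u (nth_deriv (Suc n) v) t) (at t)"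
    for n t
    using laplace_conv_has_vector_derivative[OF u s[of n]] by (simp add: nth_deriv_add)
  have N: "nth_deriv n (laplace_conv u v) = laplace_conv u (nth_deriv n v)" for n
    by (induction n) (auto simp: nth_deriv_Suc[of _ "laplace_conv u v"] intro!: ext vector_derivative_at D)
  have "smooth (laplace_conv u v)"
    unfolding smooth_def N using D differentiableI_vector by blast
  moreover have "laplace_conv u v t = 0" if t: "t \<notin> {a + c..b + d}" for t
  proof -
    \<comment> \<open>Supports add: x in [a, b] and t - x in [c, d] would put t in
      [a + c, b + d].\<close>
    have z: "u x * v (t - x) = 0" for x
      using u(2)[of x] v t by (cases "x \<in> {a..b}") (auto simp: test_functions_on_def)
    show ?thesis unfolding laplace_conv_def z by (simp add: set_lebesgue_integral_def)
  qed
  ultimately show ?thesis by (simp add: test_functions_on_def)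
qed

text \<open>Compact supports reduce the interchange of integrals to a continuous function on a
  rectangle; translating t by s then factors the kernel.\<close>

lemma laplace_laplace_conv:
  assumes u: "continuous_on UNIV u" "\<And>t. t \<notin> {a..b} \<Longrightarrow> u t = 0" "0 < a"
    and v: "v \<in> test_functions_on {c..d}" and c: "0 < c"
  shows "laplace (laplace_conv u v) z = laplace u z * laplace v z"
proof -
  have s: "smooth v" using v by (simp add: test_functions_on_def)
  let ?e = "\<lambda>t. exp (- (of_real t * z))"
  have "laplace (laplace_conv u v) z = integral {0..b + d} (\<lambda>t. ?e t * laplace_conv u v t)"
    by (rule laplace_test_function_eq_integral[OF laplace_conv_in_test_functions_on[OF u v]])
       (use u(3) c in auto)
  also have "\<dots> = integral (cbox 0 (b + d)) (\<lambda>t. integral (cbox a b) (\<lambda>s. ?e t * (u s * v (t - s))))"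
    using laplace_conv_eq_integral[OF u smooth_continuous[OF s]] by simp
  also have "\<dots> = integral (cbox a b) (\<lambda>s. integral (cbox 0 (b + d)) (\<lambda>t. ?e t * (u s * v (t - s))))"
  proof (rule integral_swap_continuous)
    have "continuous_on S (\<lambda>p. u (snd p))" "continuous_on S (\<lambda>p. v (fst p - snd p))" for S :: "(real \<times> real) set"
      by (rule continuous_on_compose2[OF u(1)], auto intro: continuous_intros)
         (rule continuous_on_compose2[OF smooth_continuous[OF s, of UNIV]], auto intro!: continuous_intros)
    then show "continuous_on (cbox (0, a) (b + d, b)) (\<lambda>(t, s). ?e t * (u s * v (t - s)))"
      unfolding split_beta by (intro continuous_intros)
  qed
  also have "\<dots> = integral (cbox a b) (\<lambda>s. ?e s * u s * laplace v z)"
  proof (rule integral_cong)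
    fix s assume s: "s \<in> cbox a b"
    have "integral {0..b + d} (\<lambda>t. ?e t * (u s * v (t - s)))
        = integral {0..b + d} (\<lambda>t. ?e s * u s * (?e (t + - s) * v (t + - s)))"
      by (intro integral_cong) (simp add: algebra_simps exp_add[symmetric])
    also have "\<dots> = ?e s * u s * integral {0..b + d} (\<lambda>t. ?e (t + - s) * v (t + - s))"
      by (rule integral_mult_right)
    also have "integral {0..b + d} (\<lambda>t. ?e (t + - s) * v (t + - s)) = integral {- s..b + d - s} (\<lambda>t. ?e t * v t)"
      using integral_shift_real_ivl[of "- s" "- s" "b + d - s" "\<lambda>t. ?e t * v t"] by simp
    \<comment> \<open>For s in [a, b] the translated interval still contains [c, d], as - s < 0 < c
      and d \<le> b + d - s.\<close>
    also have "\<dots> = laplace v z"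
      using s u(3) c by (intro laplace_test_function_eq_integral[OF v, symmetric]) auto
    finally show "integral (cbox 0 (b + d)) (\<lambda>t. ?e t * (u s * v (t - s))) = ?e s * u s * laplace v z"
      by simp
  qed
  also have "\<dots> = integral {a..b} (\<lambda>s. ?e s * u s) * laplace v z"
    by simp
  also have "integral {a..b} (\<lambda>s. ?e s * u s) = laplace u z"
    by (rule laplace_eq_integral[OF u, symmetric]) auto
  finally show ?thesis .
qed

text \<open>The conjugations of value and argument cancel on the kernel exp (- t z) and leave only
  the one on f.\<close>

lemma laplace_star_laplace: "laplace_star (laplace f) = laplace (\<lambda>s. cnj (f s))"
proof
  fix z
  have "cnj (laplace f (cnj z)) = (LINT t|lborel. cnj (indicator {0<..} t *\<^sub>R (exp (- (of_real t * cnj z)) * f t)))"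
    unfolding laplace_def set_lebesgue_integral_def by (rule Bochner_Integration.integral_cnj[symmetric])
  also have "\<dots> = laplace (\<lambda>s. cnj (f s)) z"
    unfolding laplace_def set_lebesgue_integral_def
    by (intro Bochner_Integration.integral_cong refl) (simp add: exp_cnj)
  finally show "laplace_star (laplace f) z = laplace (\<lambda>s. cnj (f s)) z" by (simp add: laplace_star_def)
qed

subsection \<open>Paley--Wiener and the sigma-function\<close>

lemma test_functions_on_linear:
  assumes f: "f \<in> test_functions_on K" and g: "g \<in> test_functions_on K"
  shows "(\<lambda>t. \<alpha> * f t + \<beta> * g t) \<in> test_functions_on K"
proof -
  have s: "smooth f" "smooth g" using f g by (auto simp: test_functions_on_def)
  have D: "((\<lambda>t. \<alpha> * nth_deriv n f t + \<beta> * nth_deriv n g t) has_vector_derivative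
      \<alpha> * nth_deriv (Suc n) f t + \<beta> * nth_deriv (Suc n) g t) (at t)" for n t
    by (intro has_vector_derivative_add has_vector_derivative_mult_right smooth_has_vector_derivative s)
  have "nth_deriv n (\<lambda>t. \<alpha> * f t + \<beta> * g t) = (\<lambda>t. \<alpha> * nth_deriv n f t + \<beta> * nth_deriv n g t)" for n
    by (induction n) (auto simp: nth_deriv_Suc[of _ "\<lambda>t. \<alpha> * f t + \<beta> * g t"] intro!: ext vector_derivative_at D)
  then have "smooth (\<lambda>t. \<alpha> * f t + \<beta> * g t)"
    unfolding smooth_def using D by (auto intro: differentiableI_vector)
  then show ?thesis using f g by (auto simp: test_functions_on_def)
qed

lemma test_functions_linear:
  assumes f: "f \<in> test_functions" and g: "g \<in> test_functions"
  shows "(\<lambda>t. \<alpha> * f t + \<beta> * g t) \<in> test_functions"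
    and "laplace (\<lambda>t. \<alpha> * f t + \<beta> * g t) z = \<alpha> * laplace f z + \<beta> * laplace g z"
proof -
  obtain a b where a: "0 < a" "a \<le> b" and f: "f \<in> test_functions_on {a..b}" using test_functionsE[OF f] .
  obtain c d where c: "0 < c" "c \<le> d" and g: "g \<in> test_functions_on {c..d}" using test_functionsE[OF g] .
  let ?h = "\<lambda>t. \<alpha> * f t + \<beta> * g t"
  define m M where "m = min a c" and "M = max b d"
  have m: "0 < m" using a c by (simp add: m_def)
  have fg: "f \<in> test_functions_on {m..M}" "g \<in> test_functions_on {m..M}"
    using f g by (auto simp: test_functions_on_def m_def M_def min_le_iff_disj le_max_iff_disj)
  have h: "?h \<in> test_functions_on {m..M}" by (rule test_functions_on_linear[OF fg])
  show "?h \<in> test_functions" by (rule test_functionsI[OF m h])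
  let ?e = "\<lambda>t. exp (- (of_real t * z))"
  have s: "smooth f" "smooth g" using f g by (auto simp: test_functions_on_def)
  have i: "(\<lambda>t. \<alpha> * (?e t * f t)) integrable_on {m..M}" "(\<lambda>t. \<beta> * (?e t * g t)) integrable_on {m..M}"
    by (intro integrable_continuous_real continuous_intros s[THEN smooth_continuous])+
  have "integral {m..M} (\<lambda>t. ?e t * ?h t) = integral {m..M} (\<lambda>t. \<alpha> * (?e t * f t) + \<beta> * (?e t * g t))"
    by (intro integral_cong) (simp add: algebra_simps)
  also have "\<dots> = \<alpha> * integral {m..M} (\<lambda>t. ?e t * f t) + \<beta> * integral {m..M} (\<lambda>t. ?e t * g t)"
    using integral_add[OF i] by simp
  finally show "laplace ?h z = \<alpha> * laplace f z + \<beta> * laplace g z"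
    using laplace_test_function_eq_integral[OF _ m order_refl order_refl, of _ M z] h fg by simp
qed

lemma laplace_inj_on: "inj_on laplace test_functions"
proof (rule inj_onI)
  fix f g assume fg: "f \<in> test_functions" "g \<in> test_functions" "laplace f = laplace g"
  let ?h = "\<lambda>t. 1 * f t + (- 1) * g t"
  have h: "?h \<in> test_functions" "\<And>z. laplace ?h z = 0"
    using test_functions_linear[OF fg(1,2), of 1 "- 1"] fg(3) by auto
  obtain a b where ab: "0 < a" "a \<le> b" "?h \<in> test_functions_on {a..b}" using test_functionsE[OF h(1)] .
  have "?h = (\<lambda>_. 0)" by (rule laplace_eq_0_imp_eq_0[OF ab(3,1,2) h(2)])
  then show "f = g" by (simp add: fun_eq_iff)
qed

lemma laplace_image: "laplace ` test_functions = laplace_space"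
proof (intro equalityI subsetI)
  fix g assume g: "g \<in> laplace_space"
  obtain a b where a: "0 < a" "a \<le> b" and z: "\<And>t. t \<notin> {a..b} \<Longrightarrow> inv_laplace g t = 0"
    and i: "\<And>z. integral {0..b} (\<lambda>t. exp (- (of_real t * z)) * inv_laplace g t) = g z"
    by (rule laplace_inv_laplace[OF g]) blast
  have t: "inv_laplace g \<in> test_functions_on {a..b}"
    using z smooth_inv_laplace[OF g] by (simp add: test_functions_on_def)
  then have "laplace (inv_laplace g) = g"
    using a i laplace_test_function_eq_integral[OF t, of 0 b] by auto
  then show "g \<in> laplace ` test_functions" using test_functionsI[OF a(1) t] by (metis imageI)
qed (use laplace_in_laplace_space in auto)

section \<open>Topologies and surjectivity of the adjoint\<close>

text \<open>The whole space is a basic neighbourhood of zero and closed under addition, hence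
  open.\<close>

lemma topspace_test_topology: "topspace test_topology = test_functions"
proof
  show "topspace test_topology \<subseteq> test_functions"
    using openin_topspace[of test_topology] unfolding openin_test_topology test_open_def by blast
  have "basic_zero_nhd test_functions"
    unfolding basic_zero_nhd_def absolutely_convex_def
    by (auto simp: test_functions_linear(1) test_functions_def[THEN eq_refl, THEN subsetD])
       (auto simp: test_functions_def intro!: exI[of _ "1::real"])
  then have "test_open test_functions"
    unfolding test_open_def using test_functions_linear(1)[of _ _ 1 1] by fastforce
  then show "test_functions \<subseteq> topspace test_topology"
    using openin_subset openin_test_topology by blast
qed

lemma inv_into_laplace: "f \<in> test_functions \<Longrightarrow> inv_into test_functions laplace (laplace f) = f"
  by (rule inv_into_f_f[OF laplace_inj_on])

lemma topspace_laplace_space_topology: "topspace laplace_space_topology = laplace_space"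
  unfolding laplace_space_topology_def topspace_pullback_topology topspace_test_topology
  using inv_into_laplace by (auto simp: laplace_image[symmetric])

text \<open>Antilinearity of the preimage comes from linearity of the Laplace transform, and
  continuity from the pullback topology, in which L^-1 is continuous.\<close>

lemma laplace_adjoint_surj:
  assumes h: "h \<in> dual_space test_topology"
  shows "h \<in> laplace_adjoint ` dual_space laplace_space_topology"
proof
  \<comment> \<open>The restriction makes \<sigma> extensional, as membership in
    \<open>dual_space\<close> demands.\<close>
  define \<sigma> where "\<sigma> = restrict (h \<circ> inv_into test_functions laplace) laplace_space"
  have h1: "h \<in> extensional test_functions" "antilinear_on test_functions h" "continuous_map test_topology euclidean h"
    using h by (auto simp: dual_space_def topspace_test_topology)
  have \<sigma>: "\<sigma> (laplace f) = h f" if "f \<in> test_functions" for f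
    using that laplace_in_laplace_space[OF that] by (simp add: \<sigma>_def inv_into_laplace)
  show "h = laplace_adjoint \<sigma>"
    using h1(1) \<sigma> by (auto simp: laplace_adjoint_def fun_eq_iff extensional_def)
  have "\<sigma> (\<lambda>z. a * g1 z + b * g2 z) = cnj a * \<sigma> g1 + cnj b * \<sigma> g2"
    if g: "g1 \<in> laplace_space" "g2 \<in> laplace_space" for g1 g2 a b
  proof -
    obtain f1 f2 where f: "f1 \<in> test_functions" "g1 = laplace f1" "f2 \<in> test_functions" "g2 = laplace f2"
      using g unfolding laplace_image[symmetric] by blast
    have "(\<lambda>z. a * g1 z + b * g2 z) = laplace (\<lambda>t. a * f1 t + b * f2 t)"
      using test_functions_linear(2)[OF f(1,3)] f by auto
    then have "\<sigma> (\<lambda>z. a * g1 z + b * g2 z) = h (\<lambda>t. a * f1 t + b * f2 t)"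
      using \<sigma> test_functions_linear(1)[OF f(1,3)] by simp
    then show ?thesis using h1(2) f \<sigma> by (simp add: antilinear_on_def)
  qed
  moreover have "continuous_map laplace_space_topology euclidean \<sigma>"
  proof (rule continuous_map_eq)
    show "continuous_map laplace_space_topology euclidean (h \<circ> inv_into test_functions laplace)"
      unfolding laplace_space_topology_def by (rule continuous_map_pullback[OF h1(3)])
  qed (simp add: \<sigma>_def topspace_laplace_space_topology)
  ultimately show "\<sigma> \<in> dual_space laplace_space_topology"
    unfolding dual_space_def topspace_laplace_space_topology antilinear_on_def
    by (auto simp: \<sigma>_def)
qed

theorem theorem2p1:
  fixes h :: "(real \<Rightarrow> complex) \<Rightarrow> complex"
    and \<sigma> :: "(complex \<Rightarrow> complex) \<Rightarrow> complex"
    and f\<^sub>1 f\<^sub>2 :: "real \<Rightarrow> complex"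
  assumes "h \<in> dual_space test_topology"
    and "\<sigma> = sigma_function h"
    and "f\<^sub>1 \<in> test_functions"
    and "f\<^sub>2 \<in> test_functions"
  shows "h (laplace_conv (\<lambda>s. cnj (f\<^sub>1 s)) f\<^sub>2) =
         \<sigma> (\<lambda>z. laplace_star (laplace f\<^sub>1) z * laplace f\<^sub>2 z)"
proof -
  let ?u = "\<lambda>s. cnj (f\<^sub>1 s)"
  obtain a b where a: "0 < a" "a \<le> b" and f1: "f\<^sub>1 \<in> test_functions_on {a..b}"
    using test_functionsE[OF assms(3)] .
  obtain c d where c: "0 < c" "c \<le> d" and f2: "f\<^sub>2 \<in> test_functions_on {c..d}"
    using test_functionsE[OF assms(4)] .
  have u: "continuous_on UNIV ?u" "\<And>t. t \<notin> {a..b} \<Longrightarrow> ?u t = 0"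
    using f1 by (simp_all add: test_functions_on_def continuous_on_cnj smooth_continuous)
  have conv: "laplace_conv ?u f\<^sub>2 \<in> test_functions"
    by (rule test_functionsI[OF _ laplace_conv_in_test_functions_on[OF u a(1) f2]]) (use a c in auto)
  \<comment> \<open>Surjectivity guarantees that the element chosen by \<open>inv_into\<close>
    really is mapped to h.\<close>
  have "h = laplace_adjoint \<sigma>"
    unfolding assms(2) sigma_function_def using laplace_adjoint_surj[OF assms(1)] by (simp add: f_inv_into_f)
  then have "h (laplace_conv ?u f\<^sub>2) = \<sigma> (laplace (laplace_conv ?u f\<^sub>2))"
    using conv by (simp add: laplace_adjoint_def)
  also have "laplace (laplace_conv ?u f\<^sub>2) = (\<lambda>z. laplace_star (laplace f\<^sub>1) z * laplace f\<^sub>2 z)"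
    using laplace_laplace_conv[OF u a(1) f2 c(1)] by (auto simp: laplace_star_laplace)
  finally show ?thesis .
qed

end
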